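(* Let $X=\{x_j\}_{j=1}^n$ and $X'=\{x'_k\}_{k=1}^m$ be two disjoint finite sets of distinct points on the real line. Let $g$ be analytic on the upper half-plane $\mathbb{C}_+=\{\operatorname{Im} w>0\}$ with $|g(i)|=1$, satisfying for some $K>0$ and $a,b,c_j,d_k\ge0$ $$\log|g(w)|\le K\frac{(1+|w|)^{2b}}{(\operatorname{Im} w)^a}\,\frac{\prod_{j=1}^n|w-x_j|^{c_j}}{\prod_{k=1}^m|w-x'_k|^{d_k}}, \qquad w\in\mathbb{C}_+.$$ Let $l:=2a-2b-\sum_{j=1}^n c_j+\sum_{k=1}^m d_k$. Then for each $\varepsilon>0$ there exists a positive number $C_9=C_9(X,X',a,b,c_j,d_k,\varepsilon)$ such that $$\sum_{\zeta\in Z(g)}\frac{(\operatorname{Im}\zeta)^{a+1+\varepsilon}}{(1+|\zeta|)^{l_1}}\,\frac{\prod_{k=1}^m|\zeta-x'_k|^{(d_k-1+\varepsilon)_+}}{\prod_{j=1}^n|\zeta-x_j|^{\min(a,c_j)}}\le C_9\cdot K,$$ where $$l_1:=2(a+1+\varepsilon)+\{l\}_{a,\varepsilon}-\sum_{j=1}^n\min(a,c_j)+\sum_{k=1}^m(d_k-1+\varepsilon)_+.$$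
   Context: $Z(g)$ denotes the zero set of $g$ in $\mathbb{C}_+$, counted with multiplicities; $a_+:=\max(a,0)$. For real $u$ write $u=u_+-u_-$ with $u_\pm\ge0$ the positive and negative parts, and for $c\ge0$, $\varepsilon>0$ set $\{u\}_{c,\varepsilon}:=(u_--1+\varepsilon)_+-\min(c,u_+)$. *)

theory Defs
  imports "HOL-Complex_Analysis.Complex_Analysis"
begin

definition pos_part :: "real \<Rightarrow> real" where
  "pos_part u = max u 0"

definition neg_part :: "real \<Rightarrow> real" where
  "neg_part u = max (- u) 0"

definition brace :: "real \<Rightarrow> real \<Rightarrow> real \<Rightarrow> real" where
  "brace u c \<epsilon> = pos_part (neg_part u - 1 + \<epsilon>) - min c (pos_part u)"

text \<open>Zero set of g in the upper half-plane (multiplicities are taken via zorder).\<close>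
definition zeros_uhp :: "(complex \<Rightarrow> complex) \<Rightarrow> complex set" where
  "zeros_uhp g = {z. Im z > 0 \<and> g z = 0}"

end

theory Submission
  imports Defs
begin

text \<open>
  After the Cayley transform \<open>z = (w - \<i>) / (w + \<i>)\<close> the majorant is comparable to
  \<open>K (1 - |z|) powr (- a)\<close> times powers \<open>|z - s| powr \<gamma>\<close> for finitely many \<open>s\<close> on the unit circle; the
  point at infinity becomes \<open>s = 1\<close> with \<open>\<gamma> = l\<close>.

  If \<open>Q\<close> is holomorphic on the disc with \<open>Re Q \<ge> 0\<close>, then \<open>B z = z exp (Q z)\<close> is a proper map from
  \<open>\<Omega> = {|B| < 1}\<close> to the disc with a single simple zero, hence injective, so \<open>- ln |B|\<close> is the Green function of
  \<open>\<Omega>\<close> with pole at 0. If moreover \<open>ln |f| \<le> Re F\<close> on \<open>\<Omega>\<close>, the Blaschke argument on \<open>\<Omega>\<close> bounds the sum of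
  \<open>- ln |B \<zeta>|\<close> over the zeros of \<open>f\<close> in \<open>\<Omega>\<close> by \<open>Re (F 0) - ln |f 0|\<close>.

  The zeros are split into dyadic cells \<open>1 - |\<zeta>| \<approx> t\<close>, \<open>|\<zeta> - s| \<approx> \<rho>\<close>, with \<open>s\<close> the nearest
  singular point. For each cell one chooses \<open>Q\<close> so small on the cell that \<open>- ln |B \<zeta>| \<ge> (1 - |\<zeta>|) / 2\<close> there,
  yet so large that on \<open>\<Omega>\<close> the majorant is below a positive harmonic function \<open>Re F\<close> with
  \<open>Re (F 0)\<close> of the expected size: a constant multiple of \<open>t\<close> keeps \<open>\<Omega>\<close> at distance \<open>t\<close> from the circle,
  Poisson kernels cut out neighbourhoods of the points with \<open>\<gamma> < 0\<close>, and a power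
  \<open>(1 - cnj s z) powr \<sigma>\<close> with \<open>\<sigma> < 1\<close> makes \<open>\<Omega>\<close> nearly conical at a point with \<open>\<gamma> \<ge> 0\<close>.
  The loss \<open>\<epsilon>\<close> makes the bounds summable over the cells.
\<close>

section \<open>A Blaschke inequality on lemniscate domains\<close>

text \<open>A proper map onto the disc takes all values equally often, and here 0 is taken once and
  simply. Counting multiplicities is avoided: the set \<open>E\<close> of values taken at two
  distinct points is open, is relatively closed off the critical values \<open>C\<close>, and misses
  0. As \<open>C\<close> is countable, the disc without \<open>C\<close> is connected, so
  \<open>E\<close> lies in \<open>C\<close>; and a countable open set is empty.\<close>

lemma inj_on_of_proper_single_zero:
  fixes B :: "complex \<Rightarrow> complex"
  assumes hol: "B holomorphic_on S" and S: "open S" "connected S"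
    and proper: "\<And>r. r < 1 \<Longrightarrow> compact {z \<in> S. norm (B z) \<le> r}"
    and z0: "z0 \<in> S" and d0: "deriv B z0 \<noteq> 0"
    and zero: "\<And>z. z \<in> S \<Longrightarrow> B z = 0 \<longleftrightarrow> z = z0"
  shows "inj_on B {z \<in> S. norm (B z) < 1}"
proof -
  define \<Omega> where "\<Omega> = {z \<in> S. norm (B z) < 1}"
  let ?D = "ball 0 1 :: complex set"
  define E where "E = {\<beta>. \<exists>z\<in>\<Omega>. \<exists>w\<in>\<Omega>. z \<noteq> w \<and> B z = \<beta> \<and> B w = \<beta>}"
  define C where "C = B ` {z \<in> S. deriv B z = 0}"
  have contB: "continuous_on S B" using hol holomorphic_on_imp_continuous_on by blast
  have nonconst: "\<not> B constant_on S"
  proof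
    assume "B constant_on S"
    then obtain k where "\<And>z. z \<in> S \<Longrightarrow> B z = k" by (auto simp: constant_on_def)
    then have "(B has_field_derivative 0) (at z0)"
      using S(1) z0 by (intro has_field_derivative_transform_within_open[of "\<lambda>_. k" 0 z0 S B]) auto
    then show False using d0 DERIV_imp_deriv by blast
  qed
  have openO: "open \<Omega>"
  proof -
    have "open (S \<inter> B -` ball 0 1)"
      using contB S(1) continuous_on_open_vimage by (metis open_ball inf_commute)
    moreover have "S \<inter> B -` ball 0 1 = \<Omega>" by (auto simp: \<Omega>_def)
    ultimately show ?thesis by simp
  qed
  have openE: "open E"
    unfolding open_subopen[of E]
  proof
    fix \<beta> assume "\<beta> \<in> E"
    then obtain z w where zw: "z \<in> \<Omega>" "w \<in> \<Omega>" "z \<noteq> w" "B z = \<beta>" "B w = \<beta>"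
      unfolding E_def by blast
    obtain U V where UV: "open U" "open V" "z \<in> U" "w \<in> V" "U \<inter> V = {}"
      using hausdorff[OF zw(3)] by blast
    have 1: "open (B ` (U \<inter> \<Omega>))" "open (B ` (V \<inter> \<Omega>))"
      using UV openO by (auto intro!: open_mapping_thm[OF hol S _ _ nonconst] simp: \<Omega>_def)
    have "B ` (U \<inter> \<Omega>) \<inter> B ` (V \<inter> \<Omega>) \<subseteq> E"
    proof
      fix v assume "v \<in> B ` (U \<inter> \<Omega>) \<inter> B ` (V \<inter> \<Omega>)"
      then obtain p q where pq: "p \<in> U" "p \<in> \<Omega>" "q \<in> V" "q \<in> \<Omega>" "B p = v" "B q = v" by auto
      have "p \<noteq> q" using pq(1,3) UV(5) by auto
      then show "v \<in> E" unfolding E_def using pq by (intro CollectI bexI[of _ p] bexI[of _ q]) auto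
    qed
    moreover have "\<beta> \<in> B ` (U \<inter> \<Omega>) \<inter> B ` (V \<inter> \<Omega>)"
      using zw UV by (metis IntI image_eqI)
    ultimately show "\<exists>T. open T \<and> \<beta> \<in> T \<and> T \<subseteq> E" using open_Int[OF 1] by blast
  qed
  have ED: "E \<subseteq> ?D" unfolding E_def \<Omega>_def by auto
  \<comment> \<open>If \<open>deriv B\<close> is constant, it equals the nonzero number
    \<open>deriv B z0\<close> and there are no critical points; otherwise its zeros in
    \<open>S\<close> are countable.\<close>
  have countC: "countable C"
  proof -
    have "countable {z \<in> S. deriv B z = 0}"
    proof (cases "deriv B constant_on S")
      case True
      then have "{z \<in> S. deriv B z = 0} = {}" using d0 z0 by (auto simp: constant_on_def)
      then show ?thesis by (simp only: countable_empty)
    next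
      case False
      obtain F :: "nat \<Rightarrow> complex set" where "\<And>n. compact (F n)" "S = \<Union>(range F)"
        using open_Union_compact_subsets[OF S(1)] by metis
      then have "fsigma S" unfolding fsigma_Union_compact by (intro exI[of _ F]) auto
      then show ?thesis
        using holomorphic_countable_zeros[OF holomorphic_deriv[OF hol S(1)] S] False by simp
    qed
    then show ?thesis unfolding C_def by simp
  qed
  \<comment> \<open>Properness in sequential form: if the values converge inside the disc, the
    points accumulate at a preimage of the limit.\<close>
  have lim: "\<exists>z\<in>\<Omega>. \<exists>r. strict_mono r \<and> B z = \<beta> \<and> (p \<circ> r) \<longlonglongrightarrow> z"
    if p: "\<And>n::nat. p n \<in> \<Omega>" and conv: "(\<lambda>n. B (p n)) \<longlonglongrightarrow> \<beta>" and \<beta>: "norm \<beta> < 1"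
    for p \<beta>
  proof -
    obtain r where r: "norm \<beta> < r" "r < 1" using \<beta> dense by blast
    have "eventually (\<lambda>n. norm (B (p n)) < r) sequentially"
      using conv r(1) by (intro order_tendstoD(2)[OF tendsto_norm]) 
    then obtain N where N: "\<And>n. n \<ge> N \<Longrightarrow> norm (B (p n)) < r" by (auto simp: eventually_sequentially)
    have "\<forall>n. p (n + N) \<in> {z \<in> S. norm (B z) \<le> r}" using N p by (force intro: less_imp_le simp: \<Omega>_def)
    then obtain z q where q: "z \<in> {z \<in> S. norm (B z) \<le> r}" "strict_mono q" "((\<lambda>n. p (n + N)) \<circ> q) \<longlonglongrightarrow> z"
      using proper[OF r(2)] unfolding compact_def by meson
    define q' where "q' = (\<lambda>n. q n + N)"
    have q': "strict_mono q'" "(p \<circ> q') \<longlonglongrightarrow> z" 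
      using q(2,3) by (auto simp: q'_def strict_mono_def o_def)
    have "(B \<circ> (p \<circ> q')) \<longlonglongrightarrow> B z"
      using contB q(1) p q'(2) unfolding continuous_on_sequentially \<Omega>_def by auto
    moreover have "(B \<circ> (p \<circ> q')) \<longlonglongrightarrow> \<beta>"
      using LIMSEQ_subseq_LIMSEQ[OF conv q'(1)] by (simp add: o_def)
    ultimately have "B z = \<beta>" using LIMSEQ_unique by blast
    then have "z \<in> \<Omega>" using q(1) \<beta> by (simp add: \<Omega>_def)
    then show ?thesis using q' \<open>B z = \<beta>\<close> by blast
  qed
  \<comment> \<open>Values in \<open>E\<close> tending to \<open>\<beta>\<close> give two sequences
    of preimages. Because \<open>\<beta>\<close> is outside \<open>E\<close>, both accumulate at the
    same point; because \<open>\<beta>\<close> is outside \<open>C\<close>, \<open>B\<close> is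
    injective near that point, so some pair would coincide.\<close>
  have nbhd: "\<exists>T. open T \<and> \<beta> \<in> T \<and> T \<inter> E = {}" if "\<beta> \<in> ?D - C - E" for \<beta>
  proof (rule ccontr)
    assume "\<not> ?thesis"
    then have ne: "\<And>T. open T \<Longrightarrow> \<beta> \<in> T \<Longrightarrow> T \<inter> E \<noteq> {}" by blast
    have "\<exists>v. v \<in> ball \<beta> (1 / Suc n) \<inter> E" for n
      using ne[of "ball \<beta> (1 / Suc n)"] by auto
    then obtain v where v: "\<And>n. v n \<in> ball \<beta> (1 / Suc n)" "\<And>n. v n \<in> E" by (metis IntE)
    have "\<forall>n. \<exists>z w. z \<in> \<Omega> \<and> w \<in> \<Omega> \<and> z \<noteq> w \<and> B z = v n \<and> B w = v n"
    proof
      fix n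
      show "\<exists>z w. z \<in> \<Omega> \<and> w \<in> \<Omega> \<and> z \<noteq> w \<and> B z = v n \<and> B w = v n"
        using v(2)[of n] unfolding E_def by blast
    qed
    then obtain p q where pq: "\<And>n. p n \<in> \<Omega>" "\<And>n. q n \<in> \<Omega>" "\<And>n. p n \<noteq> q n"
        "\<And>n. B (p n) = v n" "\<And>n. B (q n) = v n" by metis
    have vl: "v \<longlonglongrightarrow> \<beta>"
    proof (rule LIMSEQ_I)
      fix e :: real assume "e > 0"
      then obtain N where N: "inverse (real (Suc N)) < e" using reals_Archimedean by blast
      have "norm (v n - \<beta>) < e" if "N \<le> n" for n
      proof -
        have "1 / real (Suc n) \<le> inverse (real (Suc N))"
          using that by (simp add: inverse_eq_divide frac_le)
        moreover have "norm (v n - \<beta>) < 1 / real (Suc n)"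
          using v(1)[of n] by (simp add: dist_norm norm_minus_commute)
        ultimately show ?thesis using N by linarith
      qed
      then show "\<exists>no. \<forall>n\<ge>no. norm (v n - \<beta>) < e" by (intro exI[of _ N]) simp
    qed
    have n\<beta>: "norm \<beta> < 1" using that by simp
    obtain z r where z: "z \<in> \<Omega>" "strict_mono r" "B z = \<beta>" "(p \<circ> r) \<longlonglongrightarrow> z"
      using lim[of p \<beta>] pq vl n\<beta> by auto
    have "(v \<circ> r) \<longlonglongrightarrow> \<beta>" using LIMSEQ_subseq_LIMSEQ vl z(2) by blast
    then obtain w r' where w: "w \<in> \<Omega>" "strict_mono r'" "B w = \<beta>" "((q \<circ> r) \<circ> r') \<longlonglongrightarrow> w"
      using lim[of "q \<circ> r" \<beta>] pq n\<beta> by (auto simp: o_def)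
    have wz: "w = z"
    proof (rule ccontr)
      assume "w \<noteq> z"
      then have "\<beta> \<in> E" unfolding E_def using z(1,3) w(1,3) by (intro CollectI bexI[of _ w] bexI[of _ z]) auto
      then show False using that by simp
    qed
    have "deriv B z \<noteq> 0" using that z unfolding C_def \<Omega>_def by auto
    then obtain d where d: "d > 0" "inj_on B (ball z d)"
      using has_complex_derivative_locally_injective[OF hol _ S(1), of z] z(1) by (auto simp: \<Omega>_def)
    have "(p \<circ> r \<circ> r') \<longlonglongrightarrow> z" using LIMSEQ_subseq_LIMSEQ z(4) w(2) by blast
    then have 1: "\<forall>\<^sub>F n in sequentially. (p \<circ> r \<circ> r') n \<in> ball z d"
      using d(1) by (intro topological_tendstoD[where l=z]) (auto simp: o_def)
    have 2: "\<forall>\<^sub>F n in sequentially. (q \<circ> r \<circ> r') n \<in> ball z d"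
      using w(4) d(1) unfolding wz by (intro topological_tendstoD[where l=z]) (auto simp: o_def)
    obtain n where "(p \<circ> r \<circ> r') n \<in> ball z d" "(q \<circ> r \<circ> r') n \<in> ball z d"
      using eventually_happens'[OF sequentially_bot eventually_conj[OF 1 2]] by blast
    then have "p (r (r' n)) = q (r (r' n))"
      using pq(4,5) by (rule_tac inj_onD[OF d(2)]) auto
    then show False using pq(3) by blast
  qed
  \<comment> \<open>The largest open set disjoint from \<open>E\<close>; together with
    \<open>E\<close> it covers \<open>?D - C\<close>, so connectedness decides between the
    two.\<close>
  define F where "F = (\<Union>{T. open T \<and> T \<inter> E = {}})"
  have F: "open F" "F \<inter> E = {}" "?D - C - E \<subseteq> F" 
  proof -
    show "open F" unfolding F_def by auto
    show "F \<inter> E = {}" unfolding F_def by auto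
    show "?D - C - E \<subseteq> F"
    proof
      fix \<beta> assume "\<beta> \<in> ?D - C - E"
      from nbhd[OF this] show "\<beta> \<in> F" unfolding F_def by auto
    qed
  qed
  have conn: "connected (?D - C)"
    using connected_open_diff_countable[of ?D C] countC by simp
  have z0F: "0 \<in> F \<inter> (?D - C)"
  proof -
    have "0 \<notin> C" unfolding C_def using zero d0 by auto
    moreover have "0 \<notin> E" unfolding E_def \<Omega>_def using zero by auto
    ultimately show ?thesis using F by auto
  qed
  have "E \<inter> (?D - C) = {}"
  proof -
    have "E \<inter> F \<inter> (?D - C) = {}" "?D - C \<subseteq> E \<union> F" "F \<inter> (?D - C) \<noteq> {}" using F z0F by auto
    with connectedD[OF conn openE F(1)] show ?thesis by satx
  qed
  then have "E \<subseteq> C" using ED by auto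
  then have "countable E" by (rule countable_subset[OF _ countC])
  have "E = {}"
  proof (rule ccontr)
    assume "E \<noteq> {}"
    then obtain \<beta> r where "r > 0" "ball \<beta> r \<subseteq> E" using openE unfolding open_contains_ball by blast
    then have "countable (ball \<beta> r)" using countable_subset[OF _ \<open>countable E\<close>] by blast
    then show False using uncountable_ball[OF \<open>r > 0\<close>] by metis
  qed
  have eq: "z = w" if "z \<in> \<Omega>" "w \<in> \<Omega>" "B z = B w" for z w
  proof (rule ccontr)
    assume "z \<noteq> w"
    then have "B z \<in> E" unfolding E_def using that by (intro CollectI bexI[of _ z] bexI[of _ w]) auto
    then show False using \<open>E = {}\<close> by simp
  qed
  show ?thesis unfolding \<Omega>_def[symmetric] by (rule inj_onI, rule eq)
qed

text \<open>With \<open>p = norm v\<close>, the identity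
  \<open>|1 - cnj v * u|^2 = |u - v|^2 + (1 - r^2) * (1 - p^2)\<close> has a fixed second summand.
  The quotient therefore decreases as \<open>|u - v|\<close> grows, and \<open>|u - v|\<close> is at
  least \<open>r - p\<close>.\<close>

lemma pseudohyperbolic_lower_bound:
  fixes u v :: complex
  assumes "norm v < r" "norm u = r" "r < 1"
  shows "norm ((1 - cnj v * u) / (u - v)) \<le> (1 - r * norm v) / (r - norm v)"
proof -
  define p where "p = norm v"
  have p: "0 \<le> p" "p < r" using assms by (auto simp: p_def)
  have e1: "(norm (1 - cnj v * u))\<^sup>2 = (norm (u - v))\<^sup>2 + (1 - r\<^sup>2) * (1 - p\<^sup>2)"
  proof -
    have "r\<^sup>2 = (Re u)\<^sup>2 + (Im u)\<^sup>2" "p\<^sup>2 = (Re v)\<^sup>2 + (Im v)\<^sup>2"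
      unfolding p_def assms(2)[symmetric] by (simp_all add: cmod_power2)
    then show ?thesis unfolding cmod_power2 by (simp add: algebra_simps power2_eq_square)
  qed
  have nz: "r - p \<le> norm (u - v)" using norm_triangle_ineq2[of u v] assms p_def by simp
  have sq: "(r - p)\<^sup>2 \<le> (norm (u - v))\<^sup>2" using nz p by (intro power_mono) auto
  have e2: "(1 - r * p)\<^sup>2 = (r - p)\<^sup>2 + (1 - r\<^sup>2) * (1 - p\<^sup>2)" by (simp add: algebra_simps power2_eq_square)
  have "0 \<le> (1 - r\<^sup>2) * (1 - p\<^sup>2)"
    using p assms(3) by (intro mult_nonneg_nonneg) (auto simp: power_le_one)
  then have "(1 - r\<^sup>2) * (1 - p\<^sup>2) * (r - p)\<^sup>2 \<le> (1 - r\<^sup>2) * (1 - p\<^sup>2) * (norm (u - v))\<^sup>2"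
    using sq mult_left_mono by blast
  then have "(norm (1 - cnj v * u) * (r - p))\<^sup>2 \<le> ((1 - r * p) * norm (u - v))\<^sup>2"
    unfolding power_mult_distrib e1 e2 by (simp add: algebra_simps)
  moreover have "0 \<le> 1 - r * p" using p assms(3) mult_le_one[of r p] by simp
  ultimately have "norm (1 - cnj v * u) * (r - p) \<le> (1 - r * p) * norm (u - v)"
    by (intro power2_le_imp_le[of "norm (1 - cnj v * u) * (r - p)"]) auto
  moreover have "0 < norm (u - v)" using nz p by linarith
  ultimately show ?thesis using p unfolding p_def[symmetric] by (simp add: norm_divide field_simps)
qed

text \<open>\<open>B\<close> is injective on \<open>\<Omega> = {|B| < 1}\<close>, so
  \<open>(B z - B \<zeta>) / (1 - cnj (B \<zeta>) * B z)\<close> serves as the Blaschke factor of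
  \<open>\<Omega>\<close> at \<open>\<zeta>\<close>. Dividing \<open>f * exp (- F)\<close> by these
  factors gives a function bounded by 1 up to the boundary, hence also at 0, where the factors have
  modulus \<open>norm (B \<zeta>)\<close> because \<open>B 0 = 0\<close>. The cofactor
  \<open>f1\<close> may still vanish, so \<open>A\<close> can be any finite collection of
  zeros.\<close>

lemma blaschke_sum_le:
  fixes f f1 Q F :: "complex \<Rightarrow> complex" and A :: "complex set" and m :: "complex \<Rightarrow> nat"
  defines "B \<equiv> \<lambda>z. z * exp (Q z)"
  assumes holf1: "f1 holomorphic_on ball 0 1" and holQ: "Q holomorphic_on ball 0 1"
    and holF: "F holomorphic_on ball 0 1"
    and ReQ: "\<And>z. z \<in> ball 0 1 \<Longrightarrow> Re (Q z) \<ge> 0"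
    and A: "finite A" "A \<subseteq> {z \<in> ball 0 1. norm (B z) < 1}"
    and fact: "\<And>z. z \<in> ball 0 1 \<Longrightarrow> f z = f1 z * (\<Prod>\<zeta>\<in>A. (z - \<zeta>) ^ m \<zeta>)"
    and f0: "f 0 \<noteq> 0" "0 \<notin> A"
    and bound: "\<And>z. z \<in> ball 0 1 \<Longrightarrow> norm (B z) < 1 \<Longrightarrow> norm (f z) \<le> exp (Re (F z))"
  shows "(\<Sum>\<zeta>\<in>A. m \<zeta> * - ln (norm (B \<zeta>))) \<le> Re (F 0) - ln (norm (f 0))"
proof -
  let ?D = "ball 0 1 :: complex set"
  define \<Omega> where "\<Omega> = {z \<in> ?D. norm (B z) < 1}"
  have holB: "B holomorphic_on ?D" unfolding B_def by (intro holomorphic_intros holQ)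
  have contB: "continuous_on ?D B" using holB holomorphic_on_imp_continuous_on by blast
  have normB: "norm (B z) = norm z * exp (Re (Q z))" for z by (simp add: B_def norm_mult)
  have leB: "norm z \<le> norm (B z)" if "z \<in> ?D" for z
    unfolding normB using ReQ[OF that] mult_left_mono[of 1 "exp (Re (Q z))" "norm z"] by simp
  \<comment> \<open>Since \<open>norm z \<le> norm (B z)\<close>, the sublevel sets stay away from
    the unit circle; this is the properness of \<open>B\<close>.\<close>
  have comp: "compact {z \<in> ?D. norm (B z) \<le> r}" if "r < 1" for r
  proof -
    have sub: "cball 0 r \<subseteq> ?D" using that by auto
    have "{z \<in> ?D. norm (B z) \<le> r} = cball 0 r \<inter> B -` cball 0 r"
      using leB sub by force
    moreover have "closed (cball 0 r \<inter> B -` cball 0 r)"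
      by (intro continuous_closed_preimage continuous_on_subset[OF contB sub]) auto
    ultimately show ?thesis
      by (metis bounded_Int bounded_cball compact_eq_bounded_closed)
  qed
  have dB: "(B has_field_derivative exp (Q 0)) (at 0)"
  proof -
    have "(Q has_field_derivative deriv Q 0) (at 0)"
      using holQ by (intro holomorphic_derivI[OF holQ]) auto
    then show ?thesis unfolding B_def by (auto intro!: derivative_eq_intros)
  qed
  have inj: "inj_on B \<Omega>"
    unfolding \<Omega>_def
  proof (rule inj_on_of_proper_single_zero[of B ?D 0, OF holB open_ball connected_ball comp])
    show "deriv B 0 \<noteq> 0" using DERIV_imp_deriv[OF dB] by simp
  qed (auto simp: B_def)
  have openO: "open \<Omega>"
  proof -
    have "open (?D \<inter> B -` ball 0 1)"
      using contB continuous_on_open_vimage[OF open_ball] by (metis open_ball inf_commute)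
    moreover have "?D \<inter> B -` ball 0 1 = \<Omega>" by (auto simp: \<Omega>_def)
    ultimately show ?thesis by simp
  qed
  have OD: "\<Omega> \<subseteq> ?D" unfolding \<Omega>_def by auto
  have holBO: "B holomorphic_on \<Omega>" using holB OD holomorphic_on_subset by blast
  have AO: "A \<subseteq> \<Omega>" using A \<Omega>_def by simp
  \<comment> \<open>The difference quotient of \<open>B\<close> with its removable singularity
    filled in. Injectivity of \<open>B\<close> makes it zero-free on \<open>\<Omega>\<close>, at
    \<open>\<zeta>\<close> itself because an injective holomorphic map has nonzero
    derivative.\<close>
  define D where "D = (\<lambda>\<zeta> z. if z = \<zeta> then deriv B \<zeta> else (B z - B \<zeta>) / (z - \<zeta>))"
  have holD: "D \<zeta> holomorphic_on \<Omega>" for \<zeta>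
    unfolding D_def by (rule pole_lemma_open[OF holBO openO])
  have Dnz: "D \<zeta> z \<noteq> 0" if "z \<in> \<Omega>" "\<zeta> \<in> \<Omega>" for z \<zeta>
    using holomorphic_injective_imp_regular[OF holBO openO inj that(2)] inj_onD[OF inj] that
    unfolding D_def by auto
  \<comment> \<open>Written with \<open>f1\<close> and \<open>D \<zeta>\<close> so that it is
    visibly holomorphic across \<open>A\<close>; \<open>Geq\<close> identifies it off
    \<open>A\<close> with \<open>f * exp (- F)\<close> divided by the Blaschke factors.\<close>
  define G where "G = (\<lambda>z. f1 z * exp (- F z) * (\<Prod>\<zeta>\<in>A. ((1 - cnj (B \<zeta>) * B z) / D \<zeta> z) ^ m \<zeta>))"
  have holG: "G holomorphic_on \<Omega>"
    unfolding G_def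
    by (intro holomorphic_intros holBO holD holomorphic_on_subset[OF holf1 OD] holomorphic_on_subset[OF holF OD])
       (use Dnz AO in auto)
  have Geq: "G z = f z * exp (- F z) * (\<Prod>\<zeta>\<in>A. ((1 - cnj (B \<zeta>) * B z) / (B z - B \<zeta>)) ^ m \<zeta>)"
    if z: "z \<in> \<Omega>" "z \<notin> A" for z
  proof -
    have "(z - \<zeta>) ^ m \<zeta> * ((1 - cnj (B \<zeta>) * B z) / (B z - B \<zeta>)) ^ m \<zeta>
        = ((1 - cnj (B \<zeta>) * B z) / D \<zeta> z) ^ m \<zeta>" if "\<zeta> \<in> A" for \<zeta>
    proof -
      have "z \<noteq> \<zeta>" using that z by auto
      then show ?thesis unfolding power_mult_distrib[symmetric] D_def by (simp add: mult_ac)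
    qed
    then have "(\<Prod>\<zeta>\<in>A. (z - \<zeta>) ^ m \<zeta>) * (\<Prod>\<zeta>\<in>A. ((1 - cnj (B \<zeta>) * B z) / (B z - B \<zeta>)) ^ m \<zeta>)
        = (\<Prod>\<zeta>\<in>A. ((1 - cnj (B \<zeta>) * B z) / D \<zeta> z) ^ m \<zeta>)"
      unfolding prod.distrib[symmetric] by (intro prod.cong) auto
    moreover have "f z = f1 z * (\<Prod>\<zeta>\<in>A. (z - \<zeta>) ^ m \<zeta>)" using fact z OD by blast
    ultimately show ?thesis unfolding G_def by simp
  qed
  have norm_f0: "norm (G 0) = norm (f 0) * exp (- Re (F 0)) / (\<Prod>\<zeta>\<in>A. norm (B \<zeta>) ^ m \<zeta>)"
  proof -
    have "0 \<in> \<Omega>" unfolding \<Omega>_def B_def by simp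
    moreover have "B 0 = 0" unfolding B_def by simp
    ultimately show ?thesis
      using Geq[of 0] f0 by (simp add: norm_mult prod_norm[symmetric] norm_power norm_divide power_divide prod_dividef)
  qed
  have Bpos: "0 < norm (B \<zeta>)" if "\<zeta> \<in> A" for \<zeta> using that f0(2) unfolding normB by (intro mult_pos_pos) auto
  define M where "M = (\<lambda>r. \<Prod>\<zeta>\<in>A. ((1 - r * norm (B \<zeta>)) / (r - norm (B \<zeta>))) ^ m \<zeta>)"
  \<comment> \<open>Maximum principle on \<open>{|B| \<le> r}\<close> with \<open>r\<close> so close
    to 1 that \<open>A\<close> lies in the interior. On the frontier \<open>|B| = r\<close>, so each
    reciprocal Blaschke factor is at most the corresponding factor of \<open>M r\<close>.\<close>
  have Gle: "norm (G 0) \<le> M r" if r: "0 < r" "r < 1" "\<And>\<zeta>. \<zeta> \<in> A \<Longrightarrow> norm (B \<zeta>) < r" for r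
  proof (rule maximum_modulus_frontier[where f = G and \<xi> = 0 and S = "{z \<in> ?D. norm (B z) \<le> r}"])
    let ?S = "{z \<in> ?D. norm (B z) \<le> r}"
    have SO: "?S \<subseteq> \<Omega>" using r unfolding \<Omega>_def by auto
    have closedS: "closed ?S" using comp[OF r(2)] compact_imp_closed by blast
    show "G holomorphic_on interior ?S"
      using holG SO holomorphic_on_subset interior_subset by (metis order_trans)
    show "continuous_on (closure ?S) G"
      using holomorphic_on_imp_continuous_on[OF holG] SO closedS by (simp add: continuous_on_subset)
    show "bounded ?S" using comp[OF r(2)] compact_imp_bounded by blast
    show "0 \<in> ?S" using r by (simp add: B_def)
    fix z assume z: "z \<in> frontier ?S"
    then have zS: "z \<in> ?S" using closedS by (simp add: frontier_def)
    have "norm (B z) = r"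
    proof (rule ccontr)
      assume "norm (B z) \<noteq> r"
      then have "z \<in> ?D \<inter> B -` ball 0 r" using zS by auto
      moreover have "open (?D \<inter> B -` ball 0 r)"
        using contB continuous_on_open_vimage[OF open_ball] by (metis open_ball inf_commute)
      moreover have "?D \<inter> B -` ball 0 r \<subseteq> ?S" by auto
      ultimately have "z \<in> interior ?S" by (meson interiorI)
      then show False using z by (simp add: frontier_def)
    qed
    note Bz = this
    have zA: "z \<notin> A" using r(3) Bz by auto
    have zO: "z \<in> \<Omega>" using SO zS by auto
    have "norm (f z) * exp (- Re (F z)) \<le> exp (Re (F z)) * exp (- Re (F z))"
      using bound[of z] zO unfolding \<Omega>_def by (intro mult_right_mono) auto
    then have "norm (f z * exp (- F z)) \<le> 1"
      by (simp add: norm_mult mult_exp_exp)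
    moreover have "norm (\<Prod>\<zeta>\<in>A. ((1 - cnj (B \<zeta>) * B z) / (B z - B \<zeta>)) ^ m \<zeta>) \<le> M r"
      unfolding M_def prod_norm[symmetric] norm_power
      using pseudohyperbolic_lower_bound[OF r(3) Bz r(2)] by (intro prod_mono conjI power_mono) auto
    moreover have "0 \<le> norm (\<Prod>\<zeta>\<in>A. ((1 - cnj (B \<zeta>) * B z) / (B z - B \<zeta>)) ^ m \<zeta>)" by simp
    ultimately have "norm (f z * exp (- F z)) * norm (\<Prod>\<zeta>\<in>A. ((1 - cnj (B \<zeta>) * B z) / (B z - B \<zeta>)) ^ m \<zeta>)
        \<le> 1 * M r"
      by (intro mult_mono) auto
    then show "norm (G z) \<le> M r"
      unfolding Geq[OF zO zA] by (simp add: norm_mult)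
  qed
  have BA: "norm (B \<zeta>) < 1" if "\<zeta> \<in> A" for \<zeta> using that AO unfolding \<Omega>_def by auto
  have "(M \<longlongrightarrow> (\<Prod>\<zeta>\<in>A. ((1 - 1 * norm (B \<zeta>)) / (1 - norm (B \<zeta>))) ^ m \<zeta>)) (at_left 1)"
    unfolding M_def using BA by (intro tendsto_intros) force+
  moreover have "(\<Prod>\<zeta>\<in>A. ((1 - 1 * norm (B \<zeta>)) / (1 - norm (B \<zeta>))) ^ m \<zeta>) = 1"
    using BA by (intro prod.neutral) force
  ultimately have lim: "(M \<longlongrightarrow> 1) (at_left 1)" by simp
  have "\<forall>\<^sub>F r in at_left 1. \<forall>\<zeta>\<in>A. norm (B \<zeta>) < r"
    using A(1) BA eventually_at_left_field by (intro eventually_ball_finite) (auto intro: eventually_at_leftI)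
  moreover have "\<forall>\<^sub>F r in at_left (1::real). 0 < r \<and> r < 1"
    by (rule eventually_at_leftI[of 0]) auto
  ultimately have "\<forall>\<^sub>F r in at_left 1. norm (G 0) \<le> M r"
    by eventually_elim (use Gle in blast)
  then have "norm (G 0) \<le> 1"
    using tendsto_lowerbound[OF lim] trivial_limit_at_left_real by blast
  moreover have Ppos: "0 < (\<Prod>\<zeta>\<in>A. norm (B \<zeta>) ^ m \<zeta>)" using Bpos by (intro prod_pos) auto
  ultimately have le: "norm (f 0) \<le> exp (Re (F 0)) * (\<Prod>\<zeta>\<in>A. norm (B \<zeta>) ^ m \<zeta>)"
    unfolding norm_f0 by (simp add: exp_minus field_simps)
  have "ln (norm (f 0)) \<le> ln (exp (Re (F 0)) * (\<Prod>\<zeta>\<in>A. norm (B \<zeta>) ^ m \<zeta>))"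
    using le f0 Ppos by (subst ln_le_cancel_iff) auto
  also have "\<dots> = Re (F 0) + (\<Sum>\<zeta>\<in>A. m \<zeta> * ln (norm (B \<zeta>)))"
  proof -
    have "ln (\<Prod>\<zeta>\<in>A. norm (B \<zeta>) ^ m \<zeta>) = (\<Sum>\<zeta>\<in>A. m \<zeta> * ln (norm (B \<zeta>)))"
      using Bpos A(1) by (subst ln_prod) (auto simp: ln_realpow)
    then show ?thesis using Ppos by (simp add: ln_mult)
  qed
  finally show ?thesis by (simp add: sum_negf)
qed

section \<open>Barriers in the unit disc\<close>

lemma norm_one_minus_cnj_mult:
  assumes "norm s = 1"
  shows "norm (1 - cnj s * z) = norm (z - s)"
proof -
  have "cnj s * s = 1" using assms by (simp add: complex_norm_square[symmetric] mult.commute)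
  then have "1 - cnj s * z = cnj s * (s - z)" by (simp add: algebra_simps)
  then show ?thesis using assms by (simp add: norm_mult norm_minus_commute)
qed

lemma Re_one_minus_cnj_mult_pos:
  assumes "norm s = 1" "norm z < 1"
  shows "0 < Re (1 - cnj s * z)"
proof -
  have "Re (cnj s * z) \<le> norm (cnj s * z)" by (rule complex_Re_le_cmod)
  also have "\<dots> < 1" using assms by (simp add: norm_mult)
  finally show ?thesis by simp
qed

lemma dist_circle_bounds:
  fixes z s :: complex
  assumes "norm s = 1" "norm z < 1"
  shows "1 - norm z \<le> norm (z - s)" "norm (z - s) \<le> 2" "0 < norm (z - s)"
  using assms norm_triangle_ineq2[of s z] norm_triangle_ineq4[of z s] by (auto simp: norm_minus_commute)

text \<open>In the right half-plane the argument is below \<open>pi / 2\<close> in modulus, so that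
  of \<open>w powr \<tau>\<close> stays below \<open>\<bar>\<tau>\<bar> * pi / 2\<close>. Thus
  \<open>norm w powr \<tau>\<close> is comparable to a positive harmonic function; the cosine would
  degenerate to 0 at \<open>\<bar>\<tau>\<bar> = 1\<close>.\<close>

lemma Re_powr_ge:
  assumes "0 < Re w" "\<bar>\<tau>\<bar> < 1"
  shows "norm w powr \<tau> * cos (\<tau> * pi / 2) \<le> Re (w powr of_real \<tau>)"
    and "0 < cos (\<tau> * pi / 2)"
proof -
  have w: "w \<noteq> 0" using assms by auto
  have e: "\<bar>Im (Ln w)\<bar> < pi / 2" using Im_Ln_pos_lt[OF w] assms w Re_Ln_pos_lt by blast
  have le: "\<bar>\<tau> * Im (Ln w)\<bar> \<le> \<bar>\<tau>\<bar> * (pi / 2)"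
    unfolding abs_mult using e by (intro mult_left_mono) auto
  have b: "\<bar>\<tau>\<bar> * (pi / 2) < pi / 2" using assms(2) by simp
  have "cos (\<bar>\<tau>\<bar> * (pi / 2)) \<le> cos \<bar>\<tau> * Im (Ln w)\<bar>"
    using le b by (intro cos_monotone_0_pi_le) auto
  moreover have "cos (\<bar>\<tau>\<bar> * (pi / 2)) = cos (\<tau> * pi / 2)"
    by (cases "\<tau> \<ge> 0") (auto simp: abs_if)
  moreover have "cos \<bar>\<tau> * Im (Ln w)\<bar> = cos (\<tau> * Im (Ln w))"
    by (rule cos_abs_real)
  ultimately have c: "cos (\<tau> * pi / 2) \<le> cos (\<tau> * Im (Ln w))" by simp
  have "w powr of_real \<tau> = exp (of_real \<tau> * Ln w)" using w by (simp add: powr_def)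
  then have "Re (w powr of_real \<tau>) = exp (\<tau> * ln (norm w)) * cos (\<tau> * Im (Ln w))"
    using w by (simp add: Re_exp)
  also have "\<dots> = norm w powr \<tau> * cos (\<tau> * Im (Ln w))" using w by (simp add: powr_def)
  finally show "norm w powr \<tau> * cos (\<tau> * pi / 2) \<le> Re (w powr of_real \<tau>)"
    using c by (simp add: mult_left_mono)
  have "0 < cos (\<bar>\<tau>\<bar> * (pi / 2))" using b by (intro cos_gt_zero_pi) (auto intro: less_le_trans[of _ 0])
  then show "0 < cos (\<tau> * pi / 2)" using \<open>cos (\<bar>\<tau>\<bar> * (pi / 2)) = cos (\<tau> * pi / 2)\<close> by simp
qed

lemma Re_powr_le:
  fixes w :: complex
  assumes "w \<noteq> 0"
  shows "Re (w powr of_real \<tau>) \<le> norm w powr \<tau>"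
  using complex_Re_le_cmod[of "w powr of_real \<tau>"] by (simp add: norm_powr_real_powr')

lemma Re_poisson:
  fixes z s :: complex
  assumes "norm s = 1" "norm z < 1"
  shows "Re ((s + z) / (s - z)) = (1 - (norm z)\<^sup>2) / (norm (z - s))\<^sup>2"
proof -
  have "Re ((s + z) / (s - z)) = Re ((s + z) * cnj (s - z)) / (norm (s - z))\<^sup>2"
    unfolding complex_div_cnj[of "s + z"] of_real_power[symmetric] Re_divide_of_real ..
  also have "Re ((s + z) * cnj (s - z)) = (norm s)\<^sup>2 - (norm z)\<^sup>2"
    unfolding cmod_power2 by (simp add: power2_eq_square algebra_simps)
  finally show ?thesis using assms by (simp add: norm_minus_commute)
qed

text \<open>The first hypothesis says \<open>q < - ln (norm z)\<close> for nonzero \<open>z\<close>,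
  that is, \<open>z\<close> lies in \<open>\<Omega>\<close>. For \<open>norm z \<ge> 1 / 2\<close>
  the logarithm is at most \<open>2 * (1 - norm z)\<close>; for smaller \<open>norm z\<close> the
  cap \<open>P\<close> suffices.\<close>

lemma barrier_le:
  fixes z :: complex
  assumes "norm z * exp q < 1" "norm z < 1" "p \<le> q" "p \<le> P" "1 \<le> P"
  shows "p \<le> 2 * P * (1 - norm z)"
proof (cases "norm z \<ge> 1 / 2")
  case True
  have "norm z * (1 + q) \<le> norm z * exp q" by (intro mult_left_mono exp_ge_add_one_self) auto
  then have *: "norm z * q \<le> 1 - norm z" using assms(1) by (simp add: algebra_simps)
  have "p \<le> 2 * (1 - norm z)"
  proof (cases "q \<ge> 0")
    case q: True
    have "1 / 2 * q \<le> norm z * q" using True q by (intro mult_right_mono) auto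
    then show ?thesis using * assms(3) by argo
  next
    case False
    then show ?thesis using assms(2,3) by argo
  qed
  also have "\<dots> \<le> 2 * P * (1 - norm z)" using assms by (intro mult_right_mono) auto
  finally show ?thesis .
next
  case False
  then have "P * 1 \<le> P * (2 * (1 - norm z))" using assms by (intro mult_left_mono) auto
  then show ?thesis using assms(4) by (simp add: algebra_simps)
qed

text \<open>In \<open>\<Omega>\<close> near the circle \<open>q\<close> is at most
  \<open>2 * (1 - norm z)\<close>, while the Poisson kernel is about
  \<open>(1 - norm z) / |z - s|^2\<close>. The factor \<open>1 - norm z\<close> cancels, so a
  Poisson kernel of mass \<open>\<kappa> * \<rho>^2\<close> removes from \<open>\<Omega>\<close> a
  disc about \<open>s\<close> of radius comparable to \<open>\<rho>\<close>.\<close>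

lemma poisson_barrier:
  fixes z s :: complex
  assumes "norm s = 1" "norm z < 1" "norm z * exp q < 1"
    and \<kappa>: "0 < \<kappa>" "\<kappa> \<le> 1" and \<rho>: "0 < \<rho>" "\<rho> \<le> 1"
    and le: "\<kappa> * \<rho>\<^sup>2 * ((1 - (norm z)\<^sup>2) / (norm (z - s))\<^sup>2) \<le> q"
  shows "\<kappa> * \<rho> / 2 \<le> norm (z - s)"
proof -
  let ?R = "norm (z - s)"
  have R: "0 < ?R" "1 - norm z \<le> ?R" using dist_circle_bounds[OF assms(1,2)] by auto
  have \<kappa>2: "\<kappa>\<^sup>2 \<le> \<kappa>" using \<kappa> by (simp add: power2_eq_square mult_left_le)
  have \<rho>2: "\<rho>\<^sup>2 \<le> 1" using \<rho> by (simp add: power_le_one)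
  have "\<kappa> * \<rho>\<^sup>2 \<le> 4 * ?R\<^sup>2"
  proof (cases "norm z \<ge> 1 / 2")
    case True
    have "0 \<le> \<kappa> * \<rho>\<^sup>2 * ((1 - (norm z)\<^sup>2) / ?R\<^sup>2)"
      using assms(2) \<kappa> by (intro mult_nonneg_nonneg divide_nonneg_nonneg) (auto simp: power_le_one)
    then have q0: "0 \<le> q" using le by linarith
    have "norm z * (1 + q) \<le> norm z * exp q" by (intro mult_left_mono exp_ge_add_one_self) auto
    then have *: "norm z * q \<le> 1 - norm z" using assms(3) by (simp add: algebra_simps)
    have "1 / 2 * q \<le> norm z * q" using True q0 by (intro mult_right_mono) auto
    then have "q \<le> 2 * (1 - norm z)" using * by argo
    then have "\<kappa> * \<rho>\<^sup>2 * ((1 - (norm z)\<^sup>2) / ?R\<^sup>2) \<le> 2 * (1 - norm z)" using le by linarith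
    then have "\<kappa> * \<rho>\<^sup>2 * (1 - (norm z)\<^sup>2) \<le> 2 * (1 - norm z) * ?R\<^sup>2"
      using R by (simp add: divide_le_eq)
    moreover have "\<kappa> * \<rho>\<^sup>2 * (1 - (norm z)\<^sup>2) = \<kappa> * \<rho>\<^sup>2 * (1 + norm z) * (1 - norm z)"
      by (simp add: power2_eq_square algebra_simps)
    ultimately have "(\<kappa> * \<rho>\<^sup>2 * (1 + norm z)) * (1 - norm z) \<le> (2 * ?R\<^sup>2) * (1 - norm z)"
      by argo
    then have "\<kappa> * \<rho>\<^sup>2 * (1 + norm z) \<le> 2 * ?R\<^sup>2" using assms(2) by (simp add: mult_le_cancel_right)
    moreover have "\<kappa> * \<rho>\<^sup>2 * 1 \<le> \<kappa> * \<rho>\<^sup>2 * (1 + norm z)" using \<kappa> by (intro mult_left_mono) auto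
    ultimately show ?thesis by (smt (verit) zero_le_power2)
  next
    case False
    then have "(1 / 2)\<^sup>2 \<le> ?R\<^sup>2" using R by (intro power_mono) auto
    moreover have "\<kappa> * \<rho>\<^sup>2 \<le> 1 * 1" using \<kappa> \<rho>2 by (intro mult_mono) auto
    ultimately show ?thesis by (simp add: power2_eq_square)
  qed
  moreover have "\<kappa>\<^sup>2 * \<rho>\<^sup>2 \<le> \<kappa> * \<rho>\<^sup>2" using \<kappa>2 by (intro mult_right_mono) auto
  ultimately have "(\<kappa> * \<rho> / 2)\<^sup>2 \<le> ?R\<^sup>2" by (simp add: power_mult_distrib power_divide)
  then show ?thesis by (rule power2_le_imp_le) simp
qed

text \<open>The sum of both endpoint values avoids a case distinction on the sign of
  \<open>\<gamma>\<close>.\<close>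

lemma powr_le_endpoints:
  fixes x l u \<gamma> :: real
  assumes "0 < l" "l \<le> x" "x \<le> u"
  shows "x powr \<gamma> \<le> l powr \<gamma> + u powr \<gamma>"
proof (cases "\<gamma> \<ge> 0")
  case True
  then have "x powr \<gamma> \<le> u powr \<gamma>" using assms by (intro powr_mono2) auto
  then show ?thesis by (simp add: add_increasing)
next
  case False
  then have "x powr \<gamma> \<le> l powr \<gamma>" using assms by (intro powr_mono2') auto
  then show ?thesis by (simp add: add_increasing2)
qed

section \<open>Singular points on the circle, cells and their barriers\<close>

locale circle_growth =
  fixes I :: "'i set" and s :: "'i \<Rightarrow> complex" and \<gamma> :: "'i \<Rightarrow> real" and a :: real
  assumes fin: "finite I" and ns: "\<And>i. i \<in> I \<Longrightarrow> norm (s i) = 1" and a: "0 \<le> a"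
begin

definition growth :: "complex \<Rightarrow> real" where
  "growth z = (1 - norm z) powr (- a) * (\<Prod>i\<in>I. norm (z - s i) powr \<gamma> i)"

text \<open>The exponent of \<open>\<rho>\<close> lost in a cell at distance \<open>\<rho>\<close>
  from \<open>s i\<close>, up to an arbitrarily small error. For \<open>\<gamma> i = - d < 0\<close>
  it is \<open>max 0 (d - 1)\<close>, since a singularity of order below 1 fits under a positive
  harmonic function. For \<open>\<gamma> i \<ge> 0\<close> it is
  \<open>- min a (\<gamma> i)\<close>, a gain from the vanishing of the majorant.\<close>

definition crit_exp :: "'i \<Rightarrow> real" where
  "crit_exp i = max 0 (- \<gamma> i - 1) - min a (max (\<gamma> i) 0)"

text \<open>Only a lower bound on \<open>1 - norm \<zeta>\<close> is included, as the barrier asks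
  for no more; the upper bound \<open>2 * t\<close> is added when the weight is estimated.\<close>

definition cell :: "'i \<Rightarrow> real \<Rightarrow> real \<Rightarrow> real \<Rightarrow> complex set" where
  "cell i0 \<eta> t \<rho> = {\<zeta> \<in> ball 0 1. t \<le> 1 - norm \<zeta> \<and> \<rho> \<le> norm (\<zeta> - s i0) \<and> norm (\<zeta> - s i0) \<le> 2 * \<rho>
     \<and> (\<forall>i\<in>I - {i0}. \<eta> \<le> norm (\<zeta> - s i))}"

text \<open>\<open>Q\<close> determines \<open>\<Omega>\<close>. Its smallness on \<open>S\<close>
  puts \<open>S\<close> inside \<open>\<Omega>\<close> with Green function at least
  \<open>(1 - norm \<zeta>) / 2\<close>, and \<open>F\<close> has to dominate \<open>growth\<close>
  only on \<open>\<Omega>\<close>. The factor \<open>K\<close> enters later by scaling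
  \<open>F\<close>.\<close>

definition barrier :: "(complex \<Rightarrow> complex) \<Rightarrow> (complex \<Rightarrow> complex) \<Rightarrow> complex set \<Rightarrow> bool" where
  "barrier Q F S \<longleftrightarrow> Q holomorphic_on ball 0 1 \<and> F holomorphic_on ball 0 1
     \<and> (\<forall>z\<in>ball 0 1. 0 \<le> Re (Q z))
     \<and> (\<forall>\<zeta>\<in>S. Re (Q \<zeta>) \<le> (1 - norm \<zeta>) / 2)
     \<and> (\<forall>z\<in>ball 0 1. norm z * exp (Re (Q z)) < 1 \<longrightarrow> growth z \<le> Re (F z))"

text \<open>The common part \<open>Qb\<close> keeps \<open>\<Omega>\<close> at distance about
  \<open>t\<close> from the circle and at a fixed distance from the other singular points. If
  \<open>\<gamma> i0 \<ge> 0\<close>, adding a multiple of \<open>E z powr \<sigma>\<close> forces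
  \<open>1 - norm z\<close> to be at least of order
  \<open>t * (R i0 z / \<rho>) powr \<sigma>\<close>, so the vanishing of the majorant at
  \<open>s i0\<close> offsets part of its growth, and a constant \<open>F\<close> is enough. If
  \<open>\<gamma> i0 < 0\<close>, a Poisson kernel keeps \<open>\<Omega>\<close> at distance about
  \<open>\<rho>\<close> from \<open>s i0\<close>, and \<open>F\<close> is a multiple of
  \<open>E z powr (- \<tau>)\<close>. Keeping \<open>\<sigma> < 1\<close> costs the extra exponent
  \<open>(1 - \<sigma>) * (a + 1)\<close>.\<close>

lemma barrier_exists:
  assumes i0: "i0 \<in> I" and \<eta>: "0 < \<eta>" "\<eta> \<le> 1" and \<sigma>: "0 < \<sigma>" "\<sigma> < 1"
  shows "\<exists>C>0. \<forall>t \<rho>. 0 < t \<longrightarrow> t \<le> 1 \<longrightarrow> 0 < \<rho> \<longrightarrow> \<rho> \<le> 1 \<longrightarrow> t \<le> 2 * \<rho> \<longrightarrow>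
    (\<exists>Q F. barrier Q F (cell i0 \<eta> t \<rho>)
      \<and> Re (F 0) \<le> C * t powr (- a) * \<rho> powr (- (crit_exp i0 + (1 - \<sigma>) * (a + 1))))"
proof -
  note I = fin i0
  define e0 where "e0 = crit_exp i0"
  let ?D = "ball 0 1 :: complex set"
  define J where "J = I - {i0}"
  have J: "finite J" "J \<subseteq> I" "I = insert i0 J" "i0 \<notin> J" using I unfolding J_def by auto
  define N where "N = real (card J)"
  \<comment> \<open>On the cell \<open>Qb\<close> contributes at most
    \<open>\<kappa> * (1 + 2 * N) * (1 - norm \<zeta>)\<close> and the extra term at
    \<open>s i0\<close> at most \<open>2 * \<kappa> * (1 - norm \<zeta>)\<close>; the choice keeps
    their sum below \<open>(1 - norm \<zeta>) / 2\<close>.\<close>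
  define \<kappa> where "\<kappa> = 1 / (2 * (4 + 2 * N))"
  have N: "N \<ge> 0" unfolding N_def by simp
  have \<kappa>: "0 < \<kappa>" "\<kappa> \<le> 1" unfolding \<kappa>_def using N by (auto simp: field_simps)
  have \<kappa>N: "\<kappa> * (4 + 2 * N) = 1 / 2" unfolding \<kappa>_def using N by (simp add: field_simps)
  define R where "R = (\<lambda>i z. norm (z - s i))"
  have R: "1 - norm z \<le> R i z" "R i z \<le> 2" "0 < R i z" if "i \<in> I" "z \<in> ?D" for i z
    unfolding R_def using dist_circle_bounds[OF ns[OF that(1)], of z] that(2) by auto
  define P where "P = (\<lambda>i z. (s i + z) / (s i - z))"
  have snz: "s i - z \<noteq> 0" if "i \<in> I" "z \<in> ?D" for i z
    using ns[OF that(1)] that(2) by auto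
  have holP: "P i holomorphic_on ?D" if "i \<in> I" for i
    unfolding P_def using snz[OF that] by (intro holomorphic_intros) auto
  have ReP: "Re (P i z) = (1 - (norm z)\<^sup>2) / (R i z)\<^sup>2" if "i \<in> I" "z \<in> ?D" for i z
    unfolding P_def R_def using Re_poisson[OF ns[OF that(1)]] that(2) by simp
  have P0: "0 \<le> Re (P i z)" if "i \<in> I" "z \<in> ?D" for i z
    unfolding ReP[OF that] using that by (simp add: power_le_one)
  have Ple: "r\<^sup>2 * Re (P i z) \<le> 2 * (1 - norm z)" if "i \<in> I" "z \<in> ?D" "0 < r" "r \<le> R i z" for i z r
  proof -
    have "r\<^sup>2 \<le> (R i z)\<^sup>2" using that by (intro power_mono) auto
    then have "r\<^sup>2 * Re (P i z) \<le> (R i z)\<^sup>2 * Re (P i z)" using P0[OF that(1,2)] by (intro mult_right_mono)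
    also have "\<dots> = (1 + norm z) * (1 - norm z)"
      proof -
      have "(R i z)\<^sup>2 * Re (P i z) = 1 - (norm z)\<^sup>2" unfolding ReP[OF that(1,2)] using R(3)[OF that(1,2)] by simp
      then show ?thesis by (simp add: power2_eq_square algebra_simps)
    qed
    also have "\<dots> \<le> 2 * (1 - norm z)" using that(2) by (intro mult_right_mono) auto
    finally show ?thesis .
  qed
  define Qb where "Qb = (\<lambda>t z. of_real (\<kappa> * t) + (\<Sum>i\<in>J. of_real (\<kappa> * \<eta>\<^sup>2) * P i z))"
  have holQb: "Qb t holomorphic_on ?D" for t
    unfolding Qb_def by (intro holomorphic_intros holP) (use J in auto)
  have ReQb: "Re (Qb t z) = \<kappa> * t + (\<Sum>i\<in>J. \<kappa> * \<eta>\<^sup>2 * Re (P i z))" for t z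
    unfolding Qb_def by simp
  have sum0: "0 \<le> (\<Sum>i\<in>J. \<kappa> * \<eta>\<^sup>2 * Re (P i z))" if "z \<in> ?D" for z
    using P0 J that \<kappa> by (intro sum_nonneg mult_nonneg_nonneg) auto
  have Qb0: "\<kappa> * t \<le> Re (Qb t z)" if "z \<in> ?D" for t z
    unfolding ReQb using sum0[OF that] by simp
  have Qb1: "\<kappa> * \<eta>\<^sup>2 * Re (P i z) \<le> Re (Qb t z)" if "i \<in> J" "z \<in> ?D" "0 < t" for i t z
  proof -
    have "\<kappa> * \<eta>\<^sup>2 * Re (P i z) \<le> (\<Sum>i\<in>J. \<kappa> * \<eta>\<^sup>2 * Re (P i z))"
      using P0 J that \<kappa> by (intro member_le_sum) auto
    moreover have "0 \<le> \<kappa> * t" using \<kappa> that by simp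
    ultimately show ?thesis unfolding ReQb by linarith
  qed
  have Qble: "Re (Qb t z) \<le> \<kappa> * (1 + 2 * N) * (1 - norm z)"
    if "z \<in> ?D" "t \<le> 1 - norm z" "\<forall>i\<in>J. \<eta> \<le> R i z" for t z
  proof -
    have "(\<Sum>i\<in>J. \<kappa> * \<eta>\<^sup>2 * Re (P i z)) \<le> (\<Sum>i\<in>J. \<kappa> * (2 * (1 - norm z)))"
    proof (rule sum_mono)
      fix i assume "i \<in> J"
      then have "\<eta>\<^sup>2 * Re (P i z) \<le> 2 * (1 - norm z)" using Ple that \<eta> J by auto
      then show "\<kappa> * \<eta>\<^sup>2 * Re (P i z) \<le> \<kappa> * (2 * (1 - norm z))"
        using \<kappa> mult_left_mono[of _ _ \<kappa>] by (simp add: mult.assoc)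
    qed
    also have "\<dots> = N * (\<kappa> * (2 * (1 - norm z)))" unfolding N_def by simp
    finally have "(\<Sum>i\<in>J. \<kappa> * \<eta>\<^sup>2 * Re (P i z)) \<le> N * (\<kappa> * (2 * (1 - norm z)))" .
    moreover have "\<kappa> * t \<le> \<kappa> * (1 - norm z)" using that \<kappa> by (intro mult_left_mono) auto
    ultimately show ?thesis unfolding ReQb by (simp add: algebra_simps)
  qed
  \<comment> \<open>Here and in \<open>yt\<close> and \<open>Mle\<close>, \<open>q\<close> stands
    for \<open>Re (Q z)\<close> with either of the two later choices of \<open>Q\<close>, both of
    which dominate \<open>Re (Qb t z)\<close>.\<close>
  have other: "\<kappa> * \<eta> / 2 \<le> R i z"
    if "i \<in> J" "z \<in> ?D" "0 < t" "norm z * exp q < 1" "Re (Qb t z) \<le> q" for i z t q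
    unfolding R_def
  proof (rule poisson_barrier[of "s i" z q])
    show "\<kappa> * \<eta>\<^sup>2 * ((1 - (norm z)\<^sup>2) / (norm (z - s i))\<^sup>2) \<le> q"
      using Qb1[OF that(1-3)] that ReP[of i z] J unfolding R_def by auto
  qed (use that ns J \<kappa> \<eta> in auto)
  have yt: "\<kappa> / 2 * t \<le> 1 - norm z"
    if "z \<in> ?D" "0 < t" "t \<le> 1" "norm z * exp q < 1" "Re (Qb t z) \<le> q" for z t q
  proof -
    have "\<kappa> * t \<le> 1" using \<kappa> that mult_le_one[of \<kappa> t] by simp
    then have "\<kappa> * t \<le> 2 * 1 * (1 - norm z)"
      using barrier_le[of z q "\<kappa> * t" 1] that Qb0[of z t] by auto
    then show ?thesis by simp
  qed
  define M where "M = (\<Prod>i\<in>J. (\<kappa> * \<eta> / 2) powr \<gamma> i + 2 powr \<gamma> i)"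
  have Mpos: "M > 0" unfolding M_def using \<kappa> \<eta> by (intro prod_pos add_pos_pos) auto
  have Mle: "(\<Prod>i\<in>I. R i z powr \<gamma> i) \<le> M * R i0 z powr \<gamma> i0"
    if "z \<in> ?D" "0 < t" "norm z * exp q < 1" "Re (Qb t z) \<le> q" for z t q
  proof -
    have "(\<Prod>i\<in>J. R i z powr \<gamma> i) \<le> M"
      unfolding M_def
    proof (intro prod_mono conjI)
      fix i assume "i \<in> J"
      then show "R i z powr \<gamma> i \<le> (\<kappa> * \<eta> / 2) powr \<gamma> i + 2 powr \<gamma> i"
        using other[of i z t q] that R(2)[of i z] J \<kappa> \<eta> by (intro powr_le_endpoints) auto
    qed auto
    then have "R i0 z powr \<gamma> i0 * (\<Prod>i\<in>J. R i z powr \<gamma> i) \<le> R i0 z powr \<gamma> i0 * M" by (intro mult_left_mono) auto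
    then show ?thesis using J by (simp add: mult.commute)
  qed
  define E where "E = (\<lambda>z. 1 - cnj (s i0) * z)"
  have E: "0 < Re (E z)" "norm (E z) = R i0 z" "E z \<noteq> 0" if "z \<in> ?D" for z
  proof -
    show 1: "0 < Re (E z)"
      using Re_one_minus_cnj_mult_pos[OF ns[OF I(2)], of z] that unfolding E_def by simp
    show "norm (E z) = R i0 z" using norm_one_minus_cnj_mult[OF ns[OF I(2)], of z] unfolding E_def R_def .
    show "E z \<noteq> 0" using 1 by auto
  qed
  have holE: "(\<lambda>z. E z powr of_real \<tau>) holomorphic_on ?D" for \<tau>
  proof -
    have "E z \<notin> \<real>\<^sub>\<le>\<^sub>0" if "z \<in> ?D" for z
      using E(1)[OF that] by (auto simp: complex_nonpos_Reals_iff)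
    then show ?thesis unfolding E_def by (intro holomorphic_intros) auto
  qed
  \<comment> \<open>One loss covering both cases: \<open>(1 - \<sigma>) * a\<close> is lost for
    \<open>\<gamma> i0 \<ge> 0\<close>, and \<open>1 - \<sigma>\<close> for
    \<open>\<gamma> i0 < 0\<close>.\<close>
  define r where "r = (1 - \<sigma>) * (a + 1)"
  have "0 \<le> (1 - \<sigma>) * a" using \<sigma> a by simp
  moreover have "r = (1 - \<sigma>) * a + (1 - \<sigma>)" unfolding r_def by (simp add: algebra_simps)
  ultimately have r: "0 \<le> r" "1 - \<sigma> \<le> r" "(1 - \<sigma>) * a \<le> r" using \<sigma> by auto
  show ?thesis
  proof (cases "\<gamma> i0 \<ge> 0")
    case True
    \<comment> \<open>The usable order of vanishing at \<open>s i0\<close>: it is traded against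
      \<open>(1 - norm z) powr (- a)\<close>, so no more than \<open>a\<close> can be spent.\<close>
    define c where "c = min a (\<gamma> i0)"
    have c: "0 \<le> c" "c \<le> a" "c \<le> \<gamma> i0" unfolding c_def using True a by auto
    have e0: "e0 = - c" unfolding e0_def crit_exp_def c_def using True by simp
    define k where "k = cos (\<sigma> * pi / 2)"
    have k: "0 < k" "k \<le> 1" unfolding k_def using Re_powr_ge(2)[of 1 \<sigma>] \<sigma> by auto
    define A1 where "A1 = \<kappa> / 2"
    define A2 where "A2 = \<kappa> * k / 8"
    have A12: "0 < A1" "0 < A2" unfolding A1_def A2_def using \<kappa> k by auto
    define C where "C = M * 2 powr (\<gamma> i0 - c) * (A1 powr (- (a - c)) * A2 powr (- c)) * 2 powr ((1 - \<sigma>) * c)"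
    have Cpos: "C > 0" unfolding C_def using Mpos A12 by auto
    show ?thesis
    proof (intro exI[of _ C] conjI allI impI Cpos)
      fix t \<rho> :: real assume t: "0 < t" "t \<le> 1" and \<rho>: "0 < \<rho>" "\<rho> \<le> 1" and t\<rho>: "t \<le> 2 * \<rho>"
      define Q where "Q = (\<lambda>z. Qb t z + of_real (\<kappa> * t * \<rho> powr (- \<sigma>)) * E z powr of_real \<sigma>)"
      define V where "V = C * t powr (- a) * \<rho> powr (- (e0 + r))"
      have ReQ: "Re (Q z) = Re (Qb t z) + \<kappa> * t * \<rho> powr (- \<sigma>) * Re (E z powr of_real \<sigma>)" for z
        unfolding Q_def by simp
      have coef: "0 < \<kappa> * t * \<rho> powr (- \<sigma>)" using \<kappa> t \<rho> by simp
      have Elow: "R i0 z powr \<sigma> * k \<le> Re (E z powr of_real \<sigma>)" if "z \<in> ?D" for z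
        using Re_powr_ge(1)[OF E(1)[OF that], of \<sigma>] E(2)[OF that] \<sigma> unfolding k_def by simp
      have E0: "0 \<le> Re (E z powr of_real \<sigma>)" if "z \<in> ?D" for z
        by (rule order_trans[OF _ Elow[OF that]]) (use k in simp)
      have QbQ: "Re (Qb t z) \<le> Re (Q z)" if "z \<in> ?D" for z
        unfolding ReQ using E0[OF that] coef by simp
      show "\<exists>Q F. barrier Q F (cell i0 \<eta> t \<rho>)
        \<and> Re (F 0) \<le> C * t powr (- a) * \<rho> powr (- (crit_exp i0 + (1 - \<sigma>) * (a + 1)))"
        unfolding barrier_def
      proof (rule exI[of _ Q], rule exI[of _ "\<lambda>_. of_real V"], intro conjI ballI impI)
        show "Q holomorphic_on ?D" unfolding Q_def by (intro holomorphic_intros holQb holE)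
        show "0 \<le> Re (Q z)" if "z \<in> ?D" for z
          using QbQ[OF that] Qb0[OF that, of t] \<kappa> t by (smt (verit) mult_pos_pos)
        show "Re (of_real V) \<le> C * t powr (- a) * \<rho> powr (- (crit_exp i0 + (1 - \<sigma>) * (a + 1)))"
          unfolding V_def r_def e0_def by simp
      next
        fix \<zeta> assume "\<zeta> \<in> cell i0 \<eta> t \<rho>"
        then have \<zeta>: "\<zeta> \<in> ?D" "\<rho> \<le> norm (\<zeta> - s i0)" "norm (\<zeta> - s i0) \<le> 2 * \<rho>" "t \<le> 1 - norm \<zeta>"
          "\<forall>i\<in>I - {i0}. \<eta> \<le> norm (\<zeta> - s i)"
          unfolding cell_def by auto
        have 1: "Re (Qb t \<zeta>) \<le> \<kappa> * (1 + 2 * N) * (1 - norm \<zeta>)"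
          using Qble[OF \<zeta>(1,4)] \<zeta>(5) unfolding R_def J_def by auto
        have "Re (E \<zeta> powr of_real \<sigma>) \<le> R i0 \<zeta> powr \<sigma>"
          using Re_powr_le[OF E(3)[OF \<zeta>(1)]] E(2)[OF \<zeta>(1)] by simp
        also have "\<dots> \<le> (2 * \<rho>) powr \<sigma>" using \<zeta> \<rho> \<sigma> unfolding R_def by (intro powr_mono2) auto
        also have "\<dots> = 2 powr \<sigma> * \<rho> powr \<sigma>" using \<rho> by (simp add: powr_mult)
        also have "\<dots> \<le> 2 powr 1 * \<rho> powr \<sigma>" using \<sigma> by (intro mult_right_mono powr_mono) auto
        finally have "Re (E \<zeta> powr of_real \<sigma>) \<le> 2 * \<rho> powr \<sigma>" by simp
        then have "\<kappa> * t * \<rho> powr (- \<sigma>) * Re (E \<zeta> powr of_real \<sigma>) \<le> \<kappa> * t * \<rho> powr (- \<sigma>) * (2 * \<rho> powr \<sigma>)"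
          using coef by (intro mult_left_mono) auto
        also have "\<dots> = 2 * \<kappa> * t" using \<rho> by (simp add: powr_minus field_simps)
        also have "\<dots> \<le> 2 * \<kappa> * (1 - norm \<zeta>)" using \<zeta> \<kappa> by (intro mult_left_mono) auto
        finally have "Re (Q \<zeta>) \<le> \<kappa> * (3 + 2 * N) * (1 - norm \<zeta>)"
          unfolding ReQ using 1 by (simp add: algebra_simps)
        also have "\<dots> \<le> \<kappa> * (4 + 2 * N) * (1 - norm \<zeta>)"
          using \<zeta> \<kappa> by (intro mult_right_mono mult_left_mono) auto
        finally show "Re (Q \<zeta>) \<le> (1 - norm \<zeta>) / 2" unfolding \<kappa>N by simp
      next
        fix z assume z: "z \<in> ?D" "norm z * exp (Re (Q z)) < 1"
        let ?y = "1 - norm z" and ?R = "R i0 z"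
        have Rz: "0 < ?R" "?R \<le> 2" using R(2,3)[OF I(2) z(1)] by auto
        have y1: "A1 * t \<le> ?y" using yt[OF z(1) t z(2) QbQ[OF z(1)]] unfolding A1_def .
        \<comment> \<open>The nearly conical shape of \<open>\<Omega>\<close> at
          \<open>s i0\<close>. The cap 4 for \<open>barrier_le\<close> comes from
          \<open>t \<le> 2 * \<rho>\<close> and \<open>?R \<le> 2\<close>, which gives the 8 in
          \<open>A2\<close>.\<close>
        have y2: "A2 * (t * \<rho> powr (- \<sigma>) * ?R powr \<sigma>) \<le> ?y"
        proof -
          have "?R powr \<sigma> \<le> 2 powr \<sigma>" using Rz \<sigma> by (intro powr_mono2) auto
          also have "\<dots> \<le> 2 powr 1" using \<sigma> by (intro powr_mono) auto
          finally have R2: "?R powr \<sigma> \<le> 2" by simp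
          have "t * \<rho> powr (- \<sigma>) \<le> 2 * \<rho> * \<rho> powr (- \<sigma>)" using t\<rho> by (intro mult_right_mono) auto
          also have "\<dots> = 2 * \<rho> powr (1 - \<sigma>)" using \<rho> by (simp add: powr_diff powr_minus field_simps)
          also have "\<dots> \<le> 2 * 1" using \<rho> \<sigma> by (intro mult_left_mono powr_le1) auto
          finally have "t * \<rho> powr (- \<sigma>) * ?R powr \<sigma> \<le> 2 * 2" using R2 t by (intro mult_mono) auto
          then have "(\<kappa> * k) * (t * \<rho> powr (- \<sigma>) * ?R powr \<sigma>) \<le> 1 * (2 * 2)"
            using \<kappa> k t mult_le_one[of \<kappa> k] by (intro mult_mono[of "\<kappa> * k" 1]) auto
          then have p4: "\<kappa> * k * (t * \<rho> powr (- \<sigma>) * ?R powr \<sigma>) \<le> 4" by simp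
          have "\<kappa> * t * \<rho> powr (- \<sigma>) * (?R powr \<sigma> * k) \<le> \<kappa> * t * \<rho> powr (- \<sigma>) * Re (E z powr of_real \<sigma>)"
            using Elow[OF z(1)] coef by (intro mult_left_mono) auto
          also have "\<dots> \<le> Re (Q z)" unfolding ReQ using Qb0[OF z(1), of t] \<kappa> t by (smt (verit) mult_pos_pos)
          finally have "\<kappa> * k * (t * \<rho> powr (- \<sigma>) * ?R powr \<sigma>) \<le> Re (Q z)" by (simp add: mult_ac)
          from barrier_le[OF z(2) _ this p4] z(1) have "\<kappa> * k * (t * \<rho> powr (- \<sigma>) * ?R powr \<sigma>) \<le> 8 * ?y"
            by simp
          then show ?thesis unfolding A2_def by simp
        qed
        have ypos: "0 < ?y" using z(1) by simp
        \<comment> \<open>The share \<open>c\<close> of the exponent is estimated by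
          \<open>y2\<close>, the rest by \<open>y1\<close>. The resulting
          \<open>?R powr (- (\<sigma> * c))\<close> is compensated by \<open>?R powr c\<close>, and
          \<open>\<rho>\<close> keeps the power \<open>\<sigma> * c\<close> instead of the ideal
          \<open>c\<close>.\<close>
        have "?y powr (- a) = ?y powr (- (a - c)) * ?y powr (- c)" using ypos by (simp add: powr_add[symmetric])
        also have "\<dots> \<le> (A1 * t) powr (- (a - c)) * (A2 * (t * \<rho> powr (- \<sigma>) * ?R powr \<sigma>)) powr (- c)"
          using y1 y2 A12 t \<rho> Rz c by (intro mult_mono powr_mono2') auto
        also have "\<dots> = (A1 powr (- (a - c)) * A2 powr (- c)) * (t powr (- (a - c)) * t powr (- c))
            * \<rho> powr (\<sigma> * c) * ?R powr (- (\<sigma> * c))"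
          using A12 t \<rho> Rz by (simp add: powr_mult powr_powr)
        also have "t powr (- (a - c)) * t powr (- c) = t powr (- a)" using t by (simp add: powr_add[symmetric])
        finally have ya: "?y powr (- a) \<le> (A1 powr (- (a - c)) * A2 powr (- c)) * t powr (- a)
            * \<rho> powr (\<sigma> * c) * ?R powr (- (\<sigma> * c))" .
        have "?R powr \<gamma> i0 = ?R powr (\<gamma> i0 - c) * ?R powr c" using Rz by (simp add: powr_add[symmetric])
        also have "\<dots> \<le> 2 powr (\<gamma> i0 - c) * ?R powr c"
          using Rz c by (intro mult_right_mono powr_mono2) auto
        finally have Rg: "?R powr \<gamma> i0 \<le> 2 powr (\<gamma> i0 - c) * ?R powr c" .
        have "?R powr (- (\<sigma> * c)) * ?R powr c = ?R powr ((1 - \<sigma>) * c)"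
          using Rz by (simp add: powr_add[symmetric] algebra_simps)
        also have "\<dots> \<le> 2 powr ((1 - \<sigma>) * c)" using Rz c \<sigma> by (intro powr_mono2) auto
        finally have Rc: "?R powr (- (\<sigma> * c)) * ?R powr c \<le> 2 powr ((1 - \<sigma>) * c)" .
        have "(1 - \<sigma>) * c \<le> (1 - \<sigma>) * a" using c \<sigma> by (intro mult_left_mono) auto
        then have "c - r \<le> \<sigma> * c" using r by (simp add: algebra_simps)
        then have \<rho>c: "\<rho> powr (\<sigma> * c) \<le> \<rho> powr (- (e0 + r))"
          using \<rho> unfolding e0 by (intro powr_mono') auto
        have "?y powr (- a) * (\<Prod>i\<in>I. norm (z - s i) powr \<gamma> i) \<le> ?y powr (- a) * (M * ?R powr \<gamma> i0)"
          using Mle[OF z(1) t(1) z(2) QbQ[OF z(1)]] unfolding R_def by (intro mult_left_mono) auto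
        also have "\<dots> \<le> ?y powr (- a) * (M * (2 powr (\<gamma> i0 - c) * ?R powr c))"
          using Rg Mpos by (intro mult_left_mono) auto
        also have "\<dots> \<le> (A1 powr (- (a - c)) * A2 powr (- c) * t powr (- a)
            * \<rho> powr (\<sigma> * c) * ?R powr (- (\<sigma> * c))) * (M * (2 powr (\<gamma> i0 - c) * ?R powr c))"
          using ya Mpos by (intro mult_right_mono) auto
        also have "\<dots> = (M * 2 powr (\<gamma> i0 - c) * (A1 powr (- (a - c)) * A2 powr (- c)))
            * (?R powr (- (\<sigma> * c)) * ?R powr c) * t powr (- a) * \<rho> powr (\<sigma> * c)"
          by (simp add: mult_ac)
        also have "\<dots> \<le> (M * 2 powr (\<gamma> i0 - c) * (A1 powr (- (a - c)) * A2 powr (- c)))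
            * 2 powr ((1 - \<sigma>) * c) * t powr (- a) * \<rho> powr (- (e0 + r))"
          using Rc \<rho>c Mpos by (intro mult_mono mult_right_mono mult_left_mono mult_nonneg_nonneg) auto
        also have "\<dots> = V" unfolding V_def C_def by simp
        finally show "growth z \<le> Re (of_real V)" unfolding growth_def by simp
      qed (auto intro: holomorphic_intros)
    qed
  next
    case False
    define d where "d = - \<gamma> i0"
    have d: "d > 0" unfolding d_def using False by simp
    have e0: "e0 = max 0 (d - 1)" unfolding e0_def crit_exp_def d_def using False a by simp
    \<comment> \<open>\<open>F\<close> absorbs order \<open>\<tau>\<close> of the singularity, and
      \<open>\<tau> < 1\<close> keeps its real part positive. If \<open>d \<le> \<sigma>\<close>
      nothing remains; otherwise the remainder \<open>d - \<sigma>\<close> exceeds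
      \<open>max 0 (d - 1)\<close> by at most \<open>1 - \<sigma>\<close>.\<close>
    define \<tau> where "\<tau> = min d \<sigma>"
    have \<tau>: "0 < \<tau>" "\<tau> < 1" "\<tau> \<le> d" "d - \<tau> \<le> e0 + r" unfolding \<tau>_def e0 using d \<sigma> r by auto
    define k where "k = cos (- \<tau> * pi / 2)"
    have k: "0 < k" unfolding k_def using Re_powr_ge(2)[of 1 "- \<tau>"] \<tau> by auto
    define C where "C = M * (\<kappa> / 2) powr (- a) * (\<kappa> / 2) powr (- (d - \<tau>)) / k"
    have Cpos: "C > 0" unfolding C_def using Mpos \<kappa> k by auto
    show ?thesis
    proof (intro exI[of _ C] conjI allI impI Cpos)
      fix t \<rho> :: real assume t: "0 < t" "t \<le> 1" and \<rho>: "0 < \<rho>" "\<rho> \<le> 1" and t\<rho>: "t \<le> 2 * \<rho>"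
      define Q where "Q = (\<lambda>z. Qb t z + of_real (\<kappa> * \<rho>\<^sup>2) * P i0 z)"
      define V where "V = C * t powr (- a) * \<rho> powr (- (e0 + r))"
      define F where "F = (\<lambda>z. of_real V * E z powr of_real (- \<tau>))"
      have ReQ: "Re (Q z) = Re (Qb t z) + \<kappa> * \<rho>\<^sup>2 * Re (P i0 z)" for z
        unfolding Q_def by simp
      have QbQ: "Re (Qb t z) \<le> Re (Q z)" if "z \<in> ?D" for z
        unfolding ReQ using P0[OF I(2) that] \<kappa> by simp
      show "\<exists>Q F. barrier Q F (cell i0 \<eta> t \<rho>)
        \<and> Re (F 0) \<le> C * t powr (- a) * \<rho> powr (- (crit_exp i0 + (1 - \<sigma>) * (a + 1)))"
        unfolding barrier_def
      proof (rule exI[of _ Q], rule exI[of _ F], intro conjI ballI impI)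
        show "Q holomorphic_on ?D" unfolding Q_def by (intro holomorphic_intros holQb holP I)
        show "F holomorphic_on ?D" unfolding F_def by (intro holomorphic_intros holE)
        show "0 \<le> Re (Q z)" if "z \<in> ?D" for z
          using QbQ[OF that] Qb0[OF that, of t] \<kappa> t by (smt (verit) mult_pos_pos)
        show "Re (F 0) \<le> C * t powr (- a) * \<rho> powr (- (crit_exp i0 + (1 - \<sigma>) * (a + 1)))"
          unfolding V_def r_def e0_def F_def E_def by simp
      next
        fix \<zeta> assume "\<zeta> \<in> cell i0 \<eta> t \<rho>"
        then have \<zeta>: "\<zeta> \<in> ?D" "\<rho> \<le> norm (\<zeta> - s i0)" "norm (\<zeta> - s i0) \<le> 2 * \<rho>" "t \<le> 1 - norm \<zeta>"
          "\<forall>i\<in>I - {i0}. \<eta> \<le> norm (\<zeta> - s i)"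
          unfolding cell_def by auto
        have 1: "Re (Qb t \<zeta>) \<le> \<kappa> * (1 + 2 * N) * (1 - norm \<zeta>)"
          using Qble[OF \<zeta>(1,4)] \<zeta>(5) unfolding R_def J_def by auto
        have "\<rho>\<^sup>2 * Re (P i0 \<zeta>) \<le> 2 * (1 - norm \<zeta>)"
          using Ple[OF I(2) \<zeta>(1) \<rho>(1)] \<zeta>(2) unfolding R_def by simp
        then have "\<kappa> * (\<rho>\<^sup>2 * Re (P i0 \<zeta>)) \<le> \<kappa> * (2 * (1 - norm \<zeta>))" using \<kappa> by (intro mult_left_mono) auto
        then have "Re (Q \<zeta>) \<le> \<kappa> * (3 + 2 * N) * (1 - norm \<zeta>)"
          unfolding ReQ using 1 by (simp add: algebra_simps)
        also have "\<dots> \<le> \<kappa> * (4 + 2 * N) * (1 - norm \<zeta>)"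
          using \<zeta> \<kappa> by (intro mult_right_mono mult_left_mono) auto
        finally show "Re (Q \<zeta>) \<le> (1 - norm \<zeta>) / 2" unfolding \<kappa>N by simp
      next
        fix z assume z: "z \<in> ?D" "norm z * exp (Re (Q z)) < 1"
        let ?y = "1 - norm z" and ?R = "R i0 z"
        have Rz: "0 < ?R" "?R \<le> 2" using R(2,3)[OF I(2) z(1)] by auto
        have y1: "\<kappa> / 2 * t \<le> ?y" using yt[OF z(1) t z(2) QbQ[OF z(1)]] .
        have R\<rho>: "\<kappa> / 2 * \<rho> \<le> ?R"
        proof -
          have "\<kappa> * \<rho>\<^sup>2 * ((1 - (norm z)\<^sup>2) / (norm (z - s i0))\<^sup>2) \<le> Re (Q z)"
            using Qb0[OF z(1), of t] \<kappa> t ReP[OF I(2) z(1)] unfolding ReQ R_def by (smt (verit) mult_pos_pos)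
          from poisson_barrier[OF ns[OF I(2)] _ z(2) \<kappa> \<rho> this] show ?thesis using z(1) unfolding R_def by simp
        qed
        have ypos: "0 < ?y" using z(1) by simp
        have ya: "?y powr (- a) \<le> (\<kappa> / 2) powr (- a) * t powr (- a)"
        proof -
          have "?y powr (- a) \<le> (\<kappa> / 2 * t) powr (- a)" using y1 \<kappa> t a by (intro powr_mono2') auto
          then show ?thesis using \<kappa> t by (subst (asm) powr_mult) auto
        qed
        have "?R powr (- (d - \<tau>)) \<le> (\<kappa> / 2 * \<rho>) powr (- (d - \<tau>))"
          using R\<rho> \<kappa> \<rho> \<tau> by (intro powr_mono2') auto
        also have "\<dots> = (\<kappa> / 2) powr (- (d - \<tau>)) * \<rho> powr (- (d - \<tau>))"
          using \<kappa> \<rho> by (subst powr_mult) auto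
        also have "\<dots> \<le> (\<kappa> / 2) powr (- (d - \<tau>)) * \<rho> powr (- (e0 + r))"
          using \<tau> \<rho> by (intro mult_left_mono powr_mono') auto
        finally have Rd: "?R powr (- (d - \<tau>)) \<le> (\<kappa> / 2) powr (- (d - \<tau>)) * \<rho> powr (- (e0 + r))" .
        have RE: "?R powr (- \<tau>) \<le> Re (E z powr of_real (- \<tau>)) / k"
          using Re_powr_ge(1)[OF E(1)[OF z(1)], of "- \<tau>"] E(2)[OF z(1)] \<tau> k unfolding k_def
          by (simp add: le_divide_eq)
        have "?R powr \<gamma> i0 = ?R powr (- (d - \<tau>)) * ?R powr (- \<tau>)"
          using Rz unfolding d_def by (simp add: powr_add[symmetric])
        also have "\<dots> \<le> ((\<kappa> / 2) powr (- (d - \<tau>)) * \<rho> powr (- (e0 + r))) * (Re (E z powr of_real (- \<tau>)) / k)"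
          using Rd RE by (intro mult_mono) auto
        finally have Rg: "?R powr \<gamma> i0 \<le> ((\<kappa> / 2) powr (- (d - \<tau>)) * \<rho> powr (- (e0 + r))) * (Re (E z powr of_real (- \<tau>)) / k)" .
        have "?y powr (- a) * (\<Prod>i\<in>I. norm (z - s i) powr \<gamma> i) \<le> ?y powr (- a) * (M * ?R powr \<gamma> i0)"
          using Mle[OF z(1) t(1) z(2) QbQ[OF z(1)]] unfolding R_def by (intro mult_left_mono) auto
        also have "\<dots> \<le> ((\<kappa> / 2) powr (- a) * t powr (- a)) * (M * (((\<kappa> / 2) powr (- (d - \<tau>)) * \<rho> powr (- (e0 + r))) * (Re (E z powr of_real (- \<tau>)) / k)))"
          using ya Rg Mpos by (intro mult_mono mult_left_mono) auto
        also have "\<dots> = Re (F z)" unfolding F_def V_def C_def by (simp add: mult_ac)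
        finally show "growth z \<le> Re (F z)" unfolding growth_def .
      qed
    qed
  qed
qed

end

section \<open>Summation over dyadic cells\<close>

lemma dyadic_bracket:
  fixes x :: real
  assumes "0 < x" "x \<le> 2"
  shows "\<exists>k::nat. (1 / 2) ^ k \<le> x \<and> x \<le> 2 * (1 / 2) ^ k"
proof -
  define k where "k = (LEAST k. (1 / 2 :: real) ^ k \<le> x)"
  obtain k0 where "(1 / 2 :: real) ^ k0 < x" using real_arch_pow_inv[of x "1 / 2"] assms by auto
  then have k: "(1 / 2) ^ k \<le> x" unfolding k_def by (intro LeastI[of "\<lambda>k. (1 / 2 :: real) ^ k \<le> x" k0]) simp
  moreover have "x \<le> 2 * (1 / 2) ^ k"
  proof (cases k)
    case 0
    then show ?thesis using assms by simp
  next
    case (Suc j)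
    then have "\<not> (1 / 2) ^ j \<le> x" using not_less_Least[of j "\<lambda>k. (1 / 2 :: real) ^ k \<le> x"] unfolding k_def by simp
    then show ?thesis using Suc by simp
  qed
  ultimately show ?thesis by blast
qed

lemma sum_geometric_le:
  fixes q :: real
  assumes "0 \<le> q" "q < 1" "finite L"
  shows "(\<Sum>k\<in>L. q ^ k) \<le> 1 / (1 - q)"
  using sum_le_suminf[OF summable_geometric[of q] assms(3)] suminf_geometric[of q] assms by simp

section \<open>Counting zeros cell by cell\<close>

context circle_growth
begin

text \<open>\<open>A\<close> is a finite collection of zeros with multiplicities \<open>m\<close>,
  not necessarily all of them. The cofactor \<open>f1\<close> is a separate argument so that passing
  to the zeros in one cell just moves the other factors into it.\<close>

definition admissible ::
    "real \<Rightarrow> (complex \<Rightarrow> complex) \<Rightarrow> (complex \<Rightarrow> complex) \<Rightarrow> complex set \<Rightarrow> (complex \<Rightarrow> nat) \<Rightarrow> bool" where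
  "admissible K f f1 A m \<longleftrightarrow> 0 < K \<and> f1 holomorphic_on ball 0 1 \<and> finite A \<and> A \<subseteq> ball 0 1 - {0}
     \<and> (\<forall>z\<in>ball 0 1. f z = f1 z * (\<Prod>\<zeta>\<in>A. (z - \<zeta>) ^ m \<zeta>)) \<and> norm (f 0) = 1
     \<and> (\<forall>z\<in>ball 0 1. ln (norm (f z)) \<le> K * growth z)"

text \<open>The Blaschke inequality is applied with the barrier of the cell and majorant
  \<open>K * F\<close>. On the cell
  \<open>- ln |B \<zeta>| = - ln |\<zeta>| - Re (Q \<zeta>)\<close> is at least
  \<open>(1 - norm \<zeta>) / 2\<close>, which bounds the sum from below and also shows that
  \<open>A\<close> lies in \<open>\<Omega>\<close>.\<close>

lemma cell_sum_le:
  assumes i0: "i0 \<in> I" and \<eta>: "0 < \<eta>" "\<eta> \<le> 1" and \<sigma>: "0 < \<sigma>" "\<sigma> < 1"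
  shows "\<exists>C>0. \<forall>t \<rho> K f f1 A m. 0 < t \<longrightarrow> t \<le> 1 \<longrightarrow> 0 < \<rho> \<longrightarrow> \<rho> \<le> 1 \<longrightarrow> t \<le> 2 * \<rho> \<longrightarrow>
     admissible K f f1 A m \<longrightarrow> A \<subseteq> cell i0 \<eta> t \<rho> \<longrightarrow>
     (\<Sum>\<zeta>\<in>A. real (m \<zeta>) * (1 - norm \<zeta>))
       \<le> C * K * t powr (- a) * \<rho> powr (- (crit_exp i0 + (1 - \<sigma>) * (a + 1)))"
proof -
  define e0 where "e0 = crit_exp i0"
  obtain C where C: "C > 0" and bar: "\<forall>t \<rho>. 0 < t \<longrightarrow> t \<le> 1 \<longrightarrow> 0 < \<rho> \<longrightarrow> \<rho> \<le> 1 \<longrightarrow> t \<le> 2 * \<rho> \<longrightarrow>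
    (\<exists>Q F. barrier Q F (cell i0 \<eta> t \<rho>)
      \<and> Re (F 0) \<le> C * t powr (- a) * \<rho> powr (- (e0 + (1 - \<sigma>) * (a + 1))))"
    using barrier_exists[OF assms] unfolding e0_def by blast
  show ?thesis
    unfolding e0_def[symmetric]
  proof (intro exI[of _ "2 * C"] conjI allI impI)
    show "0 < 2 * C" using C by simp
    fix t \<rho> K :: real and f f1 :: "complex \<Rightarrow> complex" and A :: "complex set" and m :: "complex \<Rightarrow> nat"
    assume t: "0 < t" "t \<le> 1" "0 < \<rho>" "\<rho> \<le> 1" "t \<le> 2 * \<rho>" and adm: "admissible K f f1 A m"
      and cl: "A \<subseteq> cell i0 \<eta> t \<rho>"
    have K: "0 < K" and f1: "f1 holomorphic_on ball 0 1" and A: "finite A" "A \<subseteq> ball 0 1 - {0}"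
      and fact: "\<forall>z\<in>ball 0 1. f z = f1 z * (\<Prod>\<zeta>\<in>A. (z - \<zeta>) ^ m \<zeta>)" and f0: "norm (f 0) = 1"
      and bound: "\<forall>z\<in>ball 0 1. ln (norm (f z)) \<le> K * growth z"
      using adm unfolding admissible_def by auto
    obtain Q F where "barrier Q F (cell i0 \<eta> t \<rho>)"
      and F0: "Re (F 0) \<le> C * t powr (- a) * \<rho> powr (- (e0 + (1 - \<sigma>) * (a + 1)))"
      using bar[rule_format, OF t] by blast
    then have QF: "Q holomorphic_on ball 0 1" "F holomorphic_on ball 0 1"
      and Q0: "\<And>z. z \<in> ball 0 1 \<Longrightarrow> 0 \<le> Re (Q z)"
      and Qle: "\<And>\<zeta>. \<zeta> \<in> A \<Longrightarrow> Re (Q \<zeta>) \<le> (1 - norm \<zeta>) / 2"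
      and Fge: "\<forall>z\<in>ball 0 1. norm z * exp (Re (Q z)) < 1 \<longrightarrow> growth z \<le> Re (F z)"
      using cl unfolding barrier_def by auto
    have lnB: "(1 - norm \<zeta>) / 2 \<le> - ln (norm (\<zeta> * exp (Q \<zeta>)))" if "\<zeta> \<in> A" for \<zeta>
    proof -
      have \<zeta>: "\<zeta> \<noteq> 0" "\<zeta> \<in> ball 0 1" using that A by auto
      have "ln (norm \<zeta>) \<le> norm \<zeta> - 1" using \<zeta> by (intro ln_le_minus_one) auto
      moreover have "Re (Q \<zeta>) \<le> (1 - norm \<zeta>) / 2" by (rule Qle[OF that])
      moreover have "ln (norm (\<zeta> * exp (Q \<zeta>))) = ln (norm \<zeta>) + Re (Q \<zeta>)"
        using \<zeta> by (simp add: norm_mult ln_mult)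
      ultimately show ?thesis by argo
    qed
    have AO: "A \<subseteq> {z \<in> ball 0 1. norm (z * exp (Q z)) < 1}"
    proof
      fix \<zeta> assume \<zeta>: "\<zeta> \<in> A"
      then have "\<zeta> \<noteq> 0" "\<zeta> \<in> ball 0 1" using A by auto
      moreover have "ln (norm (\<zeta> * exp (Q \<zeta>))) < 0" using lnB[OF \<zeta>] \<open>\<zeta> \<in> ball 0 1\<close> by auto
      ultimately show "\<zeta> \<in> {z \<in> ball 0 1. norm (z * exp (Q z)) < 1}" by (simp add: ln_less_zero_iff)
    qed
    have "(\<Sum>\<zeta>\<in>A. real (m \<zeta>) * ((1 - norm \<zeta>) / 2)) \<le> (\<Sum>\<zeta>\<in>A. real (m \<zeta>) * - ln (norm (\<zeta> * exp (Q \<zeta>))))"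
      using lnB by (intro sum_mono mult_left_mono) auto
    also have "\<dots> \<le> Re (of_real K * F 0) - ln (norm (f 0))"
    proof (rule blaschke_sum_le[of f1 Q "\<lambda>z. of_real K * F z" A f m])
      show "(\<lambda>z. of_real K * F z) holomorphic_on ball 0 1" by (intro holomorphic_intros QF)
      fix z :: complex assume z: "z \<in> ball 0 1" "norm (z * exp (Q z)) < 1"
      show "norm (f z) \<le> exp (Re (of_real K * F z))"
      \<comment> \<open>\<open>ln 0 = 0\<close> by convention, so the logarithmic bound carries no
        information at a zero of \<open>f\<close>; there the claim is trivial.\<close>
      proof (cases "f z = 0")
        case False
        have "ln (norm (f z)) \<le> K * growth z"
          using bound z by blast
        also have "\<dots> \<le> K * Re (F z)" using Fge z K by (intro mult_left_mono) (auto simp: norm_mult)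
        finally have "exp (ln (norm (f z))) \<le> exp (K * Re (F z))" by simp
        then show ?thesis using False by simp
      qed simp
    qed (use f1 QF Q0 A AO fact f0 in auto)
    also have "\<dots> \<le> K * (C * t powr (- a) * \<rho> powr (- (e0 + (1 - \<sigma>) * (a + 1))))"
      using F0 K f0 by (simp add: mult_left_mono)
    finally have "(\<Sum>\<zeta>\<in>A. real (m \<zeta>) * ((1 - norm \<zeta>) / 2)) \<le> K * (C * t powr (- a) * \<rho> powr (- (e0 + (1 - \<sigma>) * (a + 1))))" .
    moreover have "(\<Sum>\<zeta>\<in>A. real (m \<zeta>) * (1 - norm \<zeta>)) = 2 * (\<Sum>\<zeta>\<in>A. real (m \<zeta>) * ((1 - norm \<zeta>) / 2))"
      unfolding sum_distrib_left by simp
    ultimately show "(\<Sum>\<zeta>\<in>A. real (m \<zeta>) * (1 - norm \<zeta>)) \<le> 2 * C * K * t powr (- a) * \<rho> powr (- (e0 + (1 - \<sigma>) * (a + 1)))"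
      by (simp add: mult_ac)
  qed
qed

text \<open>On the cell the weight is at most a constant times \<open>t powr (a + \<epsilon>) *
  \<rho> powr e0 * (1 - norm \<zeta>)\<close>. Against the unweighted bound this leaves
  \<open>t powr \<epsilon> * \<rho> powr (- r)\<close>, which \<open>t \<le> 2 * \<rho>\<close>
  converts into positive powers of both scales.\<close>

lemma weighted_cell_sum_le:
  assumes i0: "i0 \<in> I" and \<eta>: "0 < \<eta>" "\<eta> \<le> 1" and \<epsilon>: "0 < \<epsilon>" and e: "crit_exp i0 \<le> e i0"
  shows "\<exists>C>0. \<forall>t \<rho> K f f1 A m. 0 < t \<longrightarrow> t \<le> 1 \<longrightarrow> 0 < \<rho> \<longrightarrow> \<rho> \<le> 1 \<longrightarrow> t \<le> 2 * \<rho> \<longrightarrow>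
     admissible K f f1 A m \<longrightarrow> A \<subseteq> {\<zeta> \<in> cell i0 \<eta> t \<rho>. 1 - norm \<zeta> \<le> 2 * t} \<longrightarrow>
     (\<Sum>\<zeta>\<in>A. real (m \<zeta>) * ((1 - norm \<zeta>) powr (a + 1 + \<epsilon>) * (\<Prod>i\<in>I. norm (\<zeta> - s i) powr e i)))
        \<le> C * K * (t powr (\<epsilon> / 2) * \<rho> powr (\<epsilon> / 4))"
proof -
  note I = fin i0
  define e0 where "e0 = crit_exp i0"
  \<comment> \<open>Chosen so that the loss satisfies \<open>r \<le> \<epsilon> / 4\<close>; the
    minimum with \<open>1 / 2\<close> keeps \<open>\<sigma>\<close> positive.\<close>
  define \<sigma> where "\<sigma> = 1 - min (1 / 2) (\<epsilon> / (4 * (a + 1)))"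
  define r where "r = (1 - \<sigma>) * (a + 1)"
  have \<sigma>: "0 < \<sigma>" "\<sigma> < 1" unfolding \<sigma>_def using \<epsilon> a by (auto simp: min_def)
  have "1 - \<sigma> \<le> \<epsilon> / (4 * (a + 1))" unfolding \<sigma>_def by simp
  then have r: "r \<le> \<epsilon> / 4" unfolding r_def using a by (simp add: field_simps)
  obtain C where C: "C > 0" and sumle: "\<forall>t \<rho> K f f1 A m. 0 < t \<longrightarrow> t \<le> 1 \<longrightarrow> 0 < \<rho> \<longrightarrow> \<rho> \<le> 1 \<longrightarrow> t \<le> 2 * \<rho> \<longrightarrow>
     admissible K f f1 A m \<longrightarrow> A \<subseteq> cell i0 \<eta> t \<rho> \<longrightarrow>
     (\<Sum>\<zeta>\<in>A. real (m \<zeta>) * (1 - norm \<zeta>)) \<le> C * K * t powr (- a) * \<rho> powr (- (e0 + r))"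
    using cell_sum_le[OF i0 \<eta> \<sigma>] unfolding e0_def[symmetric] r_def[symmetric] by blast
  define J where "J = I - {i0}"
  have J: "finite J" "I = insert i0 J" "i0 \<notin> J" "J \<subseteq> I" using I unfolding J_def by auto
  define M where "M = (\<Prod>i\<in>J. \<eta> powr e i + 2 powr e i)"
  have Mpos: "M > 0" unfolding M_def using \<eta> by (intro prod_pos add_pos_pos) auto
  define L where "L = 2 powr (a + \<epsilon>) * (M * (2 powr (e i0 - e0) * (1 + 2 powr e0)))"
  have Lpos: "L > 0" unfolding L_def using Mpos by (intro mult_pos_pos add_pos_pos) auto
  show ?thesis
  proof (intro exI[of _ "L * C * 2 powr (\<epsilon> / 2)"] conjI allI impI)
    show "0 < L * C * 2 powr (\<epsilon> / 2)" using Lpos C by simp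
    fix t \<rho> K :: real and f f1 :: "complex \<Rightarrow> complex" and A :: "complex set" and m :: "complex \<Rightarrow> nat"
    assume t: "0 < t" "t \<le> 1" "0 < \<rho>" "\<rho> \<le> 1" "t \<le> 2 * \<rho>" and adm: "admissible K f f1 A m"
      and cl: "A \<subseteq> {\<zeta> \<in> cell i0 \<eta> t \<rho>. 1 - norm \<zeta> \<le> 2 * t}"
    have A: "finite A" "A \<subseteq> ball 0 1 - {0}" and K: "0 < K" using adm unfolding admissible_def by auto
    have W: "(1 - norm \<zeta>) powr (a + 1 + \<epsilon>) * (\<Prod>i\<in>I. norm (\<zeta> - s i) powr e i)
        \<le> (L * t powr (a + \<epsilon>) * \<rho> powr e0) * (1 - norm \<zeta>)" if \<zeta>: "\<zeta> \<in> A" for \<zeta>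
    proof -
      let ?y = "1 - norm \<zeta>" and ?R = "norm (\<zeta> - s i0)"
      have b: "t \<le> ?y" "?y \<le> 2 * t" "\<rho> \<le> ?R" "?R \<le> 2 * \<rho>" and b': "\<And>i. i \<in> J \<Longrightarrow> \<eta> \<le> norm (\<zeta> - s i)"
        using cl \<zeta> unfolding J_def cell_def by auto
      have D: "norm \<zeta> < 1" using \<zeta> A by auto
      have "?y powr (a + 1 + \<epsilon>) = ?y powr (a + \<epsilon>) * ?y"
        using D powr_add[of ?y "a + \<epsilon>" 1] by (simp add: algebra_simps)
      also have "\<dots> \<le> (2 * t) powr (a + \<epsilon>) * ?y" using b t a \<epsilon> D by (intro mult_right_mono powr_mono2) auto
      also have "(2 * t) powr (a + \<epsilon>) = 2 powr (a + \<epsilon>) * t powr (a + \<epsilon>)" using t by (subst powr_mult) auto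
      finally have 1: "?y powr (a + 1 + \<epsilon>) \<le> 2 powr (a + \<epsilon>) * t powr (a + \<epsilon>) * ?y" .
      have 2: "(\<Prod>i\<in>J. norm (\<zeta> - s i) powr e i) \<le> M"
        unfolding M_def
      proof (intro prod_mono conjI)
        fix i assume i: "i \<in> J"
        then have "norm (\<zeta> - s i) \<le> 2" using dist_circle_bounds(2)[OF ns D] J by auto
        then show "norm (\<zeta> - s i) powr e i \<le> \<eta> powr e i + 2 powr e i"
          using b'[OF i] \<eta> by (intro powr_le_endpoints) auto
      qed auto
      have "?R powr e i0 = ?R powr (e i0 - e0) * ?R powr e0" using b t by (simp add: powr_add[symmetric])
      also have "\<dots> \<le> 2 powr (e i0 - e0) * (\<rho> powr e0 + (2 * \<rho>) powr e0)"
        using b t e unfolding e0_def[symmetric] by (intro mult_mono powr_mono2 powr_le_endpoints) auto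
      also have "(2 * \<rho>) powr e0 = 2 powr e0 * \<rho> powr e0" using t by (subst powr_mult) auto
      finally have 3: "?R powr e i0 \<le> 2 powr (e i0 - e0) * (1 + 2 powr e0) * \<rho> powr e0"
        by (simp add: algebra_simps)
      have "(\<Prod>i\<in>I. norm (\<zeta> - s i) powr e i) = (\<Prod>i\<in>J. norm (\<zeta> - s i) powr e i) * ?R powr e i0"
        unfolding J(2) using J by (simp add: mult.commute)
      also have "\<dots> \<le> M * (2 powr (e i0 - e0) * (1 + 2 powr e0) * \<rho> powr e0)"
        using 2 3 Mpos by (intro mult_mono) (auto intro: prod_nonneg)
      finally have "?y powr (a + 1 + \<epsilon>) * (\<Prod>i\<in>I. norm (\<zeta> - s i) powr e i)
          \<le> (2 powr (a + \<epsilon>) * t powr (a + \<epsilon>) * ?y) * (M * (2 powr (e i0 - e0) * (1 + 2 powr e0) * \<rho> powr e0))"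
        using 1 D by (intro mult_mono) (auto intro: prod_nonneg)
      then show ?thesis unfolding L_def by (simp add: mult_ac)
    qed
    have "(\<Sum>\<zeta>\<in>A. real (m \<zeta>) * ((1 - norm \<zeta>) powr (a + 1 + \<epsilon>) * (\<Prod>i\<in>I. norm (\<zeta> - s i) powr e i)))
        \<le> (\<Sum>\<zeta>\<in>A. real (m \<zeta>) * ((L * t powr (a + \<epsilon>) * \<rho> powr e0) * (1 - norm \<zeta>)))"
      using W by (intro sum_mono mult_left_mono) auto
    also have "\<dots> = (L * t powr (a + \<epsilon>) * \<rho> powr e0) * (\<Sum>\<zeta>\<in>A. real (m \<zeta>) * (1 - norm \<zeta>))"
      unfolding sum_distrib_left by (intro sum.cong) auto
    also have "\<dots> \<le> (L * t powr (a + \<epsilon>) * \<rho> powr e0) * (C * K * t powr (- a) * \<rho> powr (- (e0 + r)))"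
    proof (rule mult_left_mono)
      show "(\<Sum>\<zeta>\<in>A. real (m \<zeta>) * (1 - norm \<zeta>)) \<le> C * K * t powr (- a) * \<rho> powr (- (e0 + r))"
        by (rule sumle[rule_format, OF t adm]) (use cl in auto)
    qed (use Lpos in auto)
    also have "\<dots> = L * C * K * ((t powr (a + \<epsilon>) * t powr (- a)) * (\<rho> powr e0 * \<rho> powr (- (e0 + r))))"
      by (simp add: mult_ac)
    also have "t powr (a + \<epsilon>) * t powr (- a) = t powr \<epsilon>" using t by (simp add: powr_add[symmetric])
    also have "\<rho> powr e0 * \<rho> powr (- (e0 + r)) = \<rho> powr (- r)" using t by (simp add: powr_add[symmetric])
    \<comment> \<open>Half of \<open>t powr \<epsilon>\<close> is exchanged for
      \<open>\<rho> powr (\<epsilon> / 2)\<close>, which outweighs \<open>\<rho> powr (- r)\<close>.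
      Positive powers in both variables are what makes the double series over cells
      converge.\<close>
    also have "L * C * K * (t powr \<epsilon> * \<rho> powr (- r)) \<le> L * C * K * (2 powr (\<epsilon> / 2) * (t powr (\<epsilon> / 2) * \<rho> powr (\<epsilon> / 4)))"
    proof (intro mult_left_mono)
      have "t powr \<epsilon> = t powr (\<epsilon> / 2) * t powr (\<epsilon> / 2)" using t by (simp add: powr_add[symmetric])
      also have "\<dots> \<le> t powr (\<epsilon> / 2) * (2 * \<rho>) powr (\<epsilon> / 2)" using t \<epsilon> by (intro mult_left_mono powr_mono2) auto
      also have "(2 * \<rho>) powr (\<epsilon> / 2) = 2 powr (\<epsilon> / 2) * \<rho> powr (\<epsilon> / 2)" using t by (subst powr_mult) auto
      finally have "t powr \<epsilon> * \<rho> powr (- r) \<le> t powr (\<epsilon> / 2) * (2 powr (\<epsilon> / 2) * \<rho> powr (\<epsilon> / 2)) * \<rho> powr (- r)"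
        by (intro mult_right_mono) auto
      also have "\<dots> = 2 powr (\<epsilon> / 2) * (t powr (\<epsilon> / 2) * \<rho> powr (\<epsilon> / 2 - r))"
        using t powr_add[of \<rho> "\<epsilon> / 2" "- r"] by simp
      also have "\<dots> \<le> 2 powr (\<epsilon> / 2) * (t powr (\<epsilon> / 2) * \<rho> powr (\<epsilon> / 4))"
        using t r by (intro mult_left_mono powr_mono') auto
      finally show "t powr \<epsilon> * \<rho> powr (- r) \<le> 2 powr (\<epsilon> / 2) * (t powr (\<epsilon> / 2) * \<rho> powr (\<epsilon> / 4))" .
    qed (use Lpos C K in auto)
    finally show "(\<Sum>\<zeta>\<in>A. real (m \<zeta>) * ((1 - norm \<zeta>) powr (a + 1 + \<epsilon>) * (\<Prod>i\<in>I. norm (\<zeta> - s i) powr e i)))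
        \<le> L * C * 2 powr (\<epsilon> / 2) * K * (t powr (\<epsilon> / 2) * \<rho> powr (\<epsilon> / 4))"
      by (simp add: mult_ac)
  qed
qed

text \<open>The factors of the discarded zeros are moved into the cofactor.\<close>

lemma admissible_subset:
  assumes adm: "admissible K f f1 A m" and "A' \<subseteq> A"
  shows "admissible K f (\<lambda>z. f1 z * (\<Prod>\<zeta>\<in>A - A'. (z - \<zeta>) ^ m \<zeta>)) A' m"
proof -
  have fA: "finite A" using adm unfolding admissible_def by blast
  have "(\<lambda>z. f1 z * (\<Prod>\<zeta>\<in>A - A'. (z - \<zeta>) ^ m \<zeta>)) holomorphic_on ball 0 1"
    using adm unfolding admissible_def by (auto intro!: holomorphic_intros)
  moreover have "(\<Prod>\<zeta>\<in>A. (z - \<zeta>) ^ m \<zeta>) = (\<Prod>\<zeta>\<in>A - A'. (z - \<zeta>) ^ m \<zeta>) * (\<Prod>\<zeta>\<in>A'. (z - \<zeta>) ^ m \<zeta>)" for z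
    by (rule prod.subset_diff[OF assms(2) fA])
  ultimately show ?thesis
    using adm assms(2) finite_subset[OF assms(2)] unfolding admissible_def by (auto simp: mult.assoc)
qed

text \<open>Each zero is assigned to one cell around its nearest singular point, with
  \<open>t\<close> and \<open>\<rho>\<close> powers of \<open>1 / 2\<close>. The cell bounds then
  form a product of two geometric series, uniformly in the function and the number of zeros.\<close>

lemma zeros_sum_le:
  assumes ne: "I \<noteq> {}" and inj: "inj_on s I" and \<epsilon>: "0 < \<epsilon>" and e: "\<And>i. i \<in> I \<Longrightarrow> crit_exp i \<le> e i"
  shows "\<exists>C>0. \<forall>K f f1 A m. admissible K f f1 A m \<longrightarrow>
     (\<Sum>\<zeta>\<in>A. real (m \<zeta>) * ((1 - norm \<zeta>) powr (a + 1 + \<epsilon>) * (\<Prod>i\<in>I. norm (\<zeta> - s i) powr e i))) \<le> C * K"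
proof -
  \<comment> \<open>Half the smallest distance between singular points, capped by 1: a point nearest
    to \<open>s i\<close> has distance at least \<open>\<eta>\<close> from all the others.\<close>
  define \<eta> where "\<eta> = Min (insert 1 ((\<lambda>(i, j). norm (s i - s j) / 2) ` {(i, j) \<in> I \<times> I. i \<noteq> j}))"
  have fp: "finite {(i, j) \<in> I \<times> I. i \<noteq> j}" using fin by (auto intro: finite_subset[of _ "I \<times> I"])
  have \<eta>1: "\<eta> \<le> 1" unfolding \<eta>_def using fp by (intro Min_le) auto
  have \<eta>0: "0 < \<eta>" unfolding \<eta>_def using fp inj by (subst Min_gr_iff) (auto dest: inj_onD)
  have \<eta>2: "2 * \<eta> \<le> norm (s i - s j)" if "i \<in> I" "j \<in> I" "i \<noteq> j" for i j
  proof -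
    have "\<eta> \<le> norm (s i - s j) / 2" unfolding \<eta>_def using fp that by (intro Min_le) (auto intro!: image_eqI[of _ _ "(i, j)"])
    then show ?thesis by simp
  qed
  define W where "W = (\<lambda>\<zeta>. (1 - norm \<zeta>) powr (a + 1 + \<epsilon>) * (\<Prod>i\<in>I. norm (\<zeta> - s i) powr e i))"
  define P where "P = (\<lambda>i0 C. 0 < C \<and> (\<forall>t \<rho> K f f1 A m. 0 < t \<longrightarrow> t \<le> 1 \<longrightarrow> 0 < \<rho> \<longrightarrow> \<rho> \<le> 1 \<longrightarrow> t \<le> 2 * \<rho> \<longrightarrow>
     admissible K f f1 A m \<longrightarrow> A \<subseteq> {\<zeta> \<in> cell i0 \<eta> t \<rho>. 1 - norm \<zeta> \<le> 2 * t} \<longrightarrow>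
     (\<Sum>\<zeta>\<in>A. real (m \<zeta>) * W \<zeta>) \<le> C * K * (t powr (\<epsilon> / 2) * \<rho> powr (\<epsilon> / 4))))"
  have "\<forall>i\<in>I. \<exists>C. P i C"
  proof
    fix i assume i: "i \<in> I"
    show "\<exists>C. P i C"
      unfolding P_def W_def by (rule weighted_cell_sum_le[of i \<eta> \<epsilon> e, OF i \<eta>0 \<eta>1 \<epsilon> e[OF i]])
  qed
  then obtain Cf where Cf: "\<And>i. i \<in> I \<Longrightarrow> P i (Cf i)" by metis
  have Cf0: "0 < Cf i" if "i \<in> I" for i using Cf[OF that] unfolding P_def by blast
  define q1 where "q1 = (1 / 2 :: real) powr (\<epsilon> / 2)"
  define q2 where "q2 = (1 / 2 :: real) powr (\<epsilon> / 4)"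
  have q: "0 \<le> q1" "q1 < 1" "0 \<le> q2" "q2 < 1"
    unfolding q1_def q2_def using \<epsilon> powr_less_mono2[of "\<epsilon> / 2" "1 / 2" 1] powr_less_mono2[of "\<epsilon> / 4" "1 / 2" 1] by auto
  have loc: "\<exists>i k j. i \<in> I \<and> \<zeta> \<in> cell i \<eta> ((1 / 2) ^ k) ((1 / 2) ^ j) \<and> 1 - norm \<zeta> \<le> 2 * (1 / 2) ^ k
      \<and> (1 / 2 :: real) ^ k \<le> 2 * (1 / 2) ^ j" if "\<zeta> \<in> ball 0 1" for \<zeta>
  proof -
    have D: "norm \<zeta> < 1" using that by simp
    obtain i where i: "i \<in> I" "\<And>j. j \<in> I \<Longrightarrow> norm (\<zeta> - s i) \<le> norm (\<zeta> - s j)"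
      using arg_min_if_finite[OF fin ne, of "\<lambda>i. norm (\<zeta> - s i)"] by (metis not_le)
    have oth: "\<eta> \<le> norm (\<zeta> - s j)" if "j \<in> I" "j \<noteq> i" for j
    proof -
      have "norm (s i - s j) \<le> norm (\<zeta> - s j) + norm (\<zeta> - s i)"
        using norm_triangle_ineq4[of "\<zeta> - s j" "\<zeta> - s i"] by simp
      then show ?thesis using \<eta>2[OF i(1) that(1)] i(2)[OF that(1)] that(2) by simp
    qed
    note R = dist_circle_bounds[OF ns[OF i(1)] D]
    obtain k where k: "(1 / 2) ^ k \<le> 1 - norm \<zeta>" "1 - norm \<zeta> \<le> 2 * (1 / 2) ^ k"
      using dyadic_bracket[of "1 - norm \<zeta>"] D norm_ge_zero[of \<zeta>] by auto
    obtain j where j: "(1 / 2) ^ j \<le> norm (\<zeta> - s i)" "norm (\<zeta> - s i) \<le> 2 * (1 / 2) ^ j"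
      using dyadic_bracket[OF R(3,2)] by blast
    have "(1 / 2 :: real) ^ k \<le> 2 * (1 / 2) ^ j" using k(1) j(2) R(1) by linarith
    then show ?thesis using i(1) k j oth that unfolding cell_def by blast
  qed
  define C where "C = (\<Sum>i\<in>I. Cf i) * (1 / (1 - q1)) * (1 / (1 - q2))"
  have C: "C > 0" unfolding C_def using q Cf0 fin ne by (intro mult_pos_pos sum_pos) auto
  have le: "(\<Sum>\<zeta>\<in>A. real (m \<zeta>) * W \<zeta>) \<le> C * K" if adm: "admissible K f f1 A m" for K f f1 A m
  proof -
    have A: "finite A" "A \<subseteq> ball 0 1" and K: "0 < K" using adm unfolding admissible_def by auto
    \<comment> \<open>Cells overlap at their common boundaries, so a choice function
      \<open>h\<close> fixes one cell per zero; its fibres partition \<open>A\<close>.\<close>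
    have "\<forall>\<zeta>\<in>A. \<exists>y. fst y \<in> I \<and> \<zeta> \<in> cell (fst y) \<eta> ((1 / 2) ^ fst (snd y)) ((1 / 2) ^ snd (snd y))
        \<and> 1 - norm \<zeta> \<le> 2 * (1 / 2) ^ fst (snd y) \<and> (1 / 2 :: real) ^ fst (snd y) \<le> 2 * (1 / 2) ^ snd (snd y)"
      using loc A(2) by (simp add: subset_iff)
    from bchoice[OF this] obtain h where h: "\<And>\<zeta>. \<zeta> \<in> A \<Longrightarrow> fst (h \<zeta>) \<in> I \<and> \<zeta> \<in> cell (fst (h \<zeta>)) \<eta> ((1 / 2) ^ fst (snd (h \<zeta>))) ((1 / 2) ^ snd (snd (h \<zeta>)))
        \<and> 1 - norm \<zeta> \<le> 2 * (1 / 2) ^ fst (snd (h \<zeta>)) \<and> (1 / 2 :: real) ^ fst (snd (h \<zeta>)) \<le> 2 * (1 / 2) ^ snd (snd (h \<zeta>))"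
      by blast
    define B where "B = (\<lambda>y :: 'i \<times> nat \<times> nat. Cf (fst y) * K * (q1 ^ fst (snd y) * q2 ^ snd (snd y)))"
    have part: "(\<Sum>\<zeta>\<in>{\<zeta> \<in> A. h \<zeta> = y}. real (m \<zeta>) * W \<zeta>) \<le> B y" if y: "y \<in> h ` A" for y
    proof -
      obtain i k j where ikj: "y = (i, k, j)" by (cases y)
      obtain \<zeta>0 where "\<zeta>0 \<in> A" "h \<zeta>0 = (i, k, j)" using y ikj by auto
      then have i: "i \<in> I" and kj: "(1 / 2 :: real) ^ k \<le> 2 * (1 / 2) ^ j" using h[of \<zeta>0] by auto
      let ?A = "{\<zeta> \<in> A. h \<zeta> = y}"
      have "?A \<subseteq> {\<zeta> \<in> cell i \<eta> ((1 / 2) ^ k) ((1 / 2) ^ j). 1 - norm \<zeta> \<le> 2 * (1 / 2) ^ k}"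
      proof
        fix \<zeta> assume "\<zeta> \<in> ?A"
        then have "\<zeta> \<in> A" "h \<zeta> = (i, k, j)" using ikj by auto
        then show "\<zeta> \<in> {\<zeta> \<in> cell i \<eta> ((1 / 2) ^ k) ((1 / 2) ^ j). 1 - norm \<zeta> \<le> 2 * (1 / 2) ^ k}"
          using h[of \<zeta>] by simp
      qed
      note sub = this
      have adm': "admissible K f (\<lambda>z. f1 z * (\<Prod>\<zeta>\<in>A - ?A. (z - \<zeta>) ^ m \<zeta>)) ?A m"
        by (rule admissible_subset[OF adm]) auto
      have pos: "0 < (1 / 2 :: real) ^ k" "(1 / 2 :: real) ^ k \<le> 1" "0 < (1 / 2 :: real) ^ j" "(1 / 2 :: real) ^ j \<le> 1"
        by (auto simp: power_le_one)
      have "(\<Sum>\<zeta>\<in>?A. real (m \<zeta>) * W \<zeta>)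
          \<le> Cf i * K * (((1 / 2) ^ k) powr (\<epsilon> / 2) * ((1 / 2) ^ j) powr (\<epsilon> / 4))"
        using Cf[OF i, unfolded P_def, THEN conjunct2, rule_format, OF pos kj adm' sub] .
      moreover have "((1 / 2 :: real) ^ k) powr (\<epsilon> / 2) = q1 ^ k" "((1 / 2 :: real) ^ j) powr (\<epsilon> / 4) = q2 ^ j"
        unfolding q1_def q2_def by (simp_all add: powr_power powr_realpow[symmetric] powr_powr mult.commute)
      ultimately show ?thesis unfolding B_def ikj by simp
    qed
    define X where "X = h ` A"
    have X: "finite X" "X \<subseteq> I \<times> (fst ` snd ` X) \<times> (snd ` snd ` X)"
    proof -
      show "finite X" unfolding X_def using A by simp
      show "X \<subseteq> I \<times> (fst ` snd ` X) \<times> (snd ` snd ` X)"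
      proof
        fix y assume y: "y \<in> X"
        then have "fst y \<in> I" unfolding X_def using h by auto
        then show "y \<in> I \<times> (fst ` snd ` X) \<times> (snd ` snd ` X)" using y by (simp add: mem_Times_iff)
      qed
    qed
    have "(\<Sum>\<zeta>\<in>A. real (m \<zeta>) * W \<zeta>) = (\<Sum>y\<in>X. \<Sum>\<zeta>\<in>{\<zeta> \<in> A. h \<zeta> = y}. real (m \<zeta>) * W \<zeta>)"
      unfolding X_def by (rule sum.image_gen[OF A(1)])
    also have "\<dots> \<le> (\<Sum>y\<in>X. B y)" using part unfolding X_def by (intro sum_mono)
    \<comment> \<open>The occupied cells are enlarged to a full product set, over which the sum
      factorizes.\<close>
    also have "\<dots> \<le> (\<Sum>y\<in>I \<times> (fst ` snd ` X) \<times> (snd ` snd ` X). B y)"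
      using X fin Cf0 K q unfolding B_def
      by (intro sum_mono2) (auto intro!: mult_nonneg_nonneg less_imp_le[OF Cf0])
    also have "\<dots> = (\<Sum>i\<in>I. Cf i) * ((\<Sum>k\<in>fst ` snd ` X. q1 ^ k) * (\<Sum>j\<in>snd ` snd ` X. q2 ^ j)) * K"
      unfolding B_def sum.cartesian_product[symmetric] sum_product
      by (simp add: sum.cartesian_product' sum_distrib_left sum_distrib_right mult_ac)
    also have "\<dots> \<le> (\<Sum>i\<in>I. Cf i) * ((1 / (1 - q1)) * (1 / (1 - q2))) * K"
      using q X(1) K Cf0 by (intro mult_right_mono mult_left_mono mult_mono sum_geometric_le sum_nonneg less_imp_le[OF Cf0]) auto
    also have "\<dots> = C * K" unfolding C_def by simp
    finally show ?thesis .
  qed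
  show ?thesis using le unfolding W_def by (intro exI[of _ C] conjI C) simp
qed

end

section \<open>Transfer to the upper half-plane\<close>

text \<open>The zeros are divided out one at a time. Near the new point the quotient is
  \<open>h\<close> over the earlier factors, away from it \<open>g1\<close> over the new factor, and
  the two expressions agree where both make sense.\<close>

lemma factor_zeros:
  fixes g :: "complex \<Rightarrow> complex" and m :: "complex \<Rightarrow> nat"
  assumes hol: "g holomorphic_on S" and S: "open S" and A: "finite A"
    and loc: "\<And>\<zeta>. \<zeta> \<in> A \<Longrightarrow> \<exists>r>0. \<exists>h. ball \<zeta> r \<subseteq> S \<and> h holomorphic_on ball \<zeta> r \<and> (\<forall>w\<in>ball \<zeta> r. g w = h w * (w - \<zeta>) ^ m \<zeta>)"
  shows "\<exists>g1. g1 holomorphic_on S \<and> (\<forall>w\<in>S. g w = g1 w * (\<Prod>\<zeta>\<in>A. (w - \<zeta>) ^ m \<zeta>))"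
  using A loc
proof (induction A rule: finite_induct)
  case empty
  then show ?case using hol by auto
next
  case (insert \<zeta> A)
  then obtain g1 where g1: "g1 holomorphic_on S" "\<And>w. w \<in> S \<Longrightarrow> g w = g1 w * (\<Prod>\<zeta>\<in>A. (w - \<zeta>) ^ m \<zeta>)"
    by auto
  obtain r h where h: "r > 0" "ball \<zeta> r \<subseteq> S" "h holomorphic_on ball \<zeta> r"
    "\<And>w. w \<in> ball \<zeta> r \<Longrightarrow> g w = h w * (w - \<zeta>) ^ m \<zeta>"
    using insert.prems[of \<zeta>] by auto
  define P where "P = (\<lambda>w. \<Prod>\<zeta>\<in>A. (w - \<zeta>) ^ m \<zeta>)"
  define U where "U = ball \<zeta> r - A"
  have U: "open U" "\<zeta> \<in> U" "U \<subseteq> S" unfolding U_def using insert.hyps h finite_imp_closed by (auto intro!: open_Diff)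
  have Pnz: "P w \<noteq> 0" if "w \<in> U" for w unfolding P_def using insert.hyps that U_def by auto
  define g2 where "g2 = (\<lambda>w. if w = \<zeta> then h \<zeta> / P \<zeta> else g1 w / (w - \<zeta>) ^ m \<zeta>)"
  have eqU: "g2 w = h w / P w" if "w \<in> U" for w
  proof (cases "w = \<zeta>")
    case False
    have "g1 w * P w = h w * (w - \<zeta>) ^ m \<zeta>"
      using g1(2)[of w] h(4)[of w] that U unfolding P_def U_def by auto
    then show ?thesis unfolding g2_def using False Pnz[OF that] by (simp add: field_simps)
  qed (simp add: g2_def)
  have "(\<lambda>w. h w / P w) holomorphic_on U"
    using Pnz holomorphic_on_subset[OF h(3)] unfolding P_def U_def by (intro holomorphic_intros) auto
  then have "g2 holomorphic_on U" using eqU by (simp cong: holomorphic_cong)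
  moreover have "g2 holomorphic_on S - {\<zeta>}"
  proof -
    have "(\<lambda>w. g1 w / (w - \<zeta>) ^ m \<zeta>) holomorphic_on S - {\<zeta>}"
      by (intro holomorphic_intros holomorphic_on_subset[OF g1(1)]) auto
    then show ?thesis unfolding g2_def by (rule holomorphic_transform) auto
  qed
  ultimately have "g2 holomorphic_on (U \<union> (S - {\<zeta>}))" using U S by (intro holomorphic_on_Un) auto
  moreover have "U \<union> (S - {\<zeta>}) = S" using U by auto
  moreover have "g w = g2 w * (\<Prod>\<zeta>\<in>insert \<zeta> A. (w - \<zeta>) ^ m \<zeta>)" if "w \<in> S" for w
  proof (cases "w = \<zeta>")
    case True
    then show ?thesis
      using h(1) h(4)[of \<zeta>] eqU[OF U(2)] Pnz[OF U(2)] insert.hyps unfolding P_def[symmetric] by (simp add: P_def)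
  next
    case False
    then show ?thesis using g1(2)[OF that] insert.hyps unfolding g2_def by simp
  qed
  ultimately show ?case by auto
qed

text \<open>Because \<open>S\<close> is connected and \<open>g w0\<close> is nonzero,
  \<open>g\<close> has finite order at every point of \<open>S\<close>, so \<open>zor_poly\<close>
  supplies the local factorizations.\<close>

lemma factor_zorder:
  assumes hol: "g holomorphic_on S" and S: "open S" "connected S" and nz: "w0 \<in> S" "g w0 \<noteq> 0"
    and A: "finite A" "A \<subseteq> S"
  shows "\<exists>g1. g1 holomorphic_on S \<and> (\<forall>w\<in>S. g w = g1 w * (\<Prod>\<zeta>\<in>A. (w - \<zeta>) ^ nat (zorder g \<zeta>)))"
proof (rule factor_zeros[OF hol S(1) A(1)])
  fix \<zeta> assume "\<zeta> \<in> A"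
  then obtain r where r: "r > 0" "cball \<zeta> r \<subseteq> S" "zor_poly g \<zeta> holomorphic_on cball \<zeta> r"
    "\<forall>w\<in>cball \<zeta> r. g w = zor_poly g \<zeta> w * (w - \<zeta>) ^ nat (zorder g \<zeta>)"
    using zorder_exist_zero[OF hol S, of \<zeta>] A nz by blast
  then show "\<exists>r>0. \<exists>h. ball \<zeta> r \<subseteq> S \<and> h holomorphic_on ball \<zeta> r \<and> (\<forall>w\<in>ball \<zeta> r. g w = h w * (w - \<zeta>) ^ nat (zorder g \<zeta>))"
    using ball_subset_cball[of \<zeta> r] by (intro exI[of _ r] conjI exI[of _ "zor_poly g \<zeta>"]) (auto intro: holomorphic_on_subset)
qed

section \<open>The Cayley transform between half-plane and disc\<close>

definition cayley :: "complex \<Rightarrow> complex" where "cayley w = (w - \<i>) / (w + \<i>)"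

definition cayley_inv :: "complex \<Rightarrow> complex" where "cayley_inv z = \<i> * (1 + z) / (1 - z)"

lemma plus_i_nz: "Im w \<ge> 0 \<Longrightarrow> w + \<i> \<noteq> 0"
  by (auto simp: complex_eq_iff)

lemma norm_plus_i_bounds:
  assumes "Im w \<ge> 0"
  shows "norm (w + \<i>) \<le> 1 + norm w" "1 + norm w \<le> 2 * norm (w + \<i>)"
proof -
  show "norm (w + \<i>) \<le> 1 + norm w" using norm_triangle_ineq[of w \<i>] by simp
  have "(norm (w + \<i>))\<^sup>2 = (norm w)\<^sup>2 + 2 * Im w + 1"
    unfolding cmod_power2 by (simp add: power2_eq_square algebra_simps)
  then have "(norm w)\<^sup>2 \<le> (norm (w + \<i>))\<^sup>2" "1\<^sup>2 \<le> (norm (w + \<i>))\<^sup>2" using assms by auto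
  then have "norm w \<le> norm (w + \<i>)" "1 \<le> norm (w + \<i>)" by (auto intro: power2_le_imp_le)
  then show "1 + norm w \<le> 2 * norm (w + \<i>)" by simp
qed

lemma cayley_one_minus: "Im w > 0 \<Longrightarrow> 1 - (norm (cayley w))\<^sup>2 = 4 * Im w / (norm (w + \<i>))\<^sup>2"
proof -
  assume w: "Im w > 0"
  have nz: "norm (w + \<i>) \<noteq> 0" using plus_i_nz[of w] w by simp
  have "1 - (norm (cayley w))\<^sup>2 = ((norm (w + \<i>))\<^sup>2 - (norm (w - \<i>))\<^sup>2) / (norm (w + \<i>))\<^sup>2"
  proof -
    have "norm (cayley w) = norm (w - \<i>) / norm (w + \<i>)" by (simp add: cayley_def norm_divide)
    then show ?thesis using nz by (simp add: power_divide diff_divide_distrib del: norm_eq_zero)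
  qed
  also have "(norm (w + \<i>))\<^sup>2 - (norm (w - \<i>))\<^sup>2 = 4 * Im w"
    unfolding cmod_power2 by (simp add: power2_eq_square algebra_simps)
  finally show ?thesis .
qed

lemma cayley_in_ball: "Im w > 0 \<Longrightarrow> cayley w \<in> ball 0 1"
proof -
  assume w: "Im w > 0"
  have "0 < 4 * Im w / (norm (w + \<i>))\<^sup>2" using plus_i_nz[of w] w by simp
  then have "(norm (cayley w))\<^sup>2 < 1\<^sup>2" using cayley_one_minus[OF w] by simp
  then have "norm (cayley w) < 1" by (rule power2_less_imp_less) simp
  then show ?thesis by simp
qed

lemma cayley_diff:
  assumes "Im w \<ge> 0" "Im v \<ge> 0"
  shows "cayley w - cayley v = 2 * \<i> * (w - v) / ((w + \<i>) * (v + \<i>))"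
  unfolding cayley_def using plus_i_nz[OF assms(1)] plus_i_nz[OF assms(2)] by (simp add: field_simps)

lemma cayley_minus_one: "Im w \<ge> 0 \<Longrightarrow> cayley w - 1 = - 2 * \<i> / (w + \<i>)"
  unfolding cayley_def using plus_i_nz[of w] by (simp add: field_simps)

lemma cayley_inv_cayley: "Im w > 0 \<Longrightarrow> cayley_inv (cayley w) = w"
proof -
  assume w: "Im w > 0"
  have nz: "w + \<i> \<noteq> 0" using plus_i_nz[of w] w by simp
  have 1: "1 - cayley w = 2 * \<i> / (w + \<i>)" "1 + cayley w = 2 * w / (w + \<i>)"
    unfolding cayley_def using nz by (simp_all add: field_simps)
  show ?thesis unfolding cayley_inv_def 1 using nz by simp
qed

lemma cayley_cayley_inv:
  assumes "z \<in> ball 0 1"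
  shows "cayley (cayley_inv z) = z"
proof -
  have "1 - z \<noteq> 0" using assms by auto
  then have "cayley_inv z - \<i> = 2 * \<i> * z / (1 - z)" "cayley_inv z + \<i> = 2 * \<i> / (1 - z)"
    unfolding cayley_inv_def by (simp_all add: field_simps)
  then show ?thesis unfolding cayley_def using \<open>1 - z \<noteq> 0\<close> by simp
qed

lemma Im_cayley_inv_pos:
  assumes "z \<in> ball 0 1"
  shows "0 < Im (cayley_inv z)"
proof -
  have "cayley_inv z = \<i> * ((1 + z) / (1 - z))" unfolding cayley_inv_def by simp
  then have "Im (cayley_inv z) = Re ((1 + z) / (1 - z))" by (simp only: Im_i_times)
  also have "\<dots> = (1 - (norm z)\<^sup>2) / (norm (z - 1))\<^sup>2" using Re_poisson[of 1 z] assms by simp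
  also have "\<dots> > 0" using assms by (auto simp: power_less_one_iff abs_square_less_1 intro!: divide_pos_pos)
  finally show ?thesis .
qed

lemma norm_cayley_real: "norm (cayley (of_real x)) = 1"
proof -
  have "norm (of_real x - \<i>) = norm (of_real x + \<i>)" unfolding cmod_def by simp
  moreover have "norm (of_real x + \<i>) \<noteq> 0" using plus_i_nz[of "of_real x"] by simp
  ultimately show ?thesis unfolding cayley_def by (simp add: norm_divide)
qed

section \<open>Comparison of weights on the disc and on the half-plane\<close>

lemma powr_le_of_comparable:
  fixes u v C :: real
  assumes "0 < u" "0 < v" "u \<le> C * v" "v \<le> C * u"
  shows "u powr p \<le> C powr \<bar>p\<bar> * v powr p"
proof -
  have C: "0 < C" using assms by (smt (verit) mult_nonpos_nonneg)
  show ?thesis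
  proof (cases "p \<ge> 0")
    case True
    then have "u powr p \<le> (C * v) powr p" using assms by (intro powr_mono2) auto
    then show ?thesis using True C assms by (simp add: powr_mult)
  next
    case False
    have "u powr p \<le> (v / C) powr p" using assms False C by (intro powr_mono2') (auto simp: field_simps)
    then show ?thesis using False C assms by (simp add: powr_divide powr_minus field_simps)
  qed
qed

definition disc_weight :: "nat \<Rightarrow> nat \<Rightarrow> (nat \<Rightarrow> real) \<Rightarrow> (nat \<Rightarrow> real) \<Rightarrow> real \<Rightarrow> (nat \<Rightarrow> real) \<Rightarrow> (nat \<Rightarrow> real) \<Rightarrow> real \<Rightarrow> complex \<Rightarrow> real" where
  "disc_weight n m x x' p q q' v z = (1 - norm z) powr p *
     ((\<Prod>j<n. norm (z - cayley (of_real (x j))) powr q j)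
      * ((\<Prod>k<m. norm (z - cayley (of_real (x' k))) powr q' k) * norm (z - 1) powr v))"

text \<open>The power of \<open>1 + norm w\<close> makes each factor scale correctly:
  \<open>1 - norm z\<close> corresponds to \<open>Im w / (1 + norm w)^2\<close>, the distance to a
  finite singular point to \<open>norm (w - x) / (1 + norm w)\<close>, and the distance to 1 to
  \<open>1 / (1 + norm w)\<close>. So \<open>v\<close> is the exponent at infinity. Both the
  majorant and the weight of the zero sum have this form.\<close>

definition uhp_weight :: "nat \<Rightarrow> nat \<Rightarrow> (nat \<Rightarrow> real) \<Rightarrow> (nat \<Rightarrow> real) \<Rightarrow> real \<Rightarrow> (nat \<Rightarrow> real) \<Rightarrow> (nat \<Rightarrow> real) \<Rightarrow> real \<Rightarrow> complex \<Rightarrow> real" where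
  "uhp_weight n m x x' p q q' v w = Im w powr p * (\<Prod>j<n. norm (w - of_real (x j)) powr q j)
     * (\<Prod>k<m. norm (w - of_real (x' k)) powr q' k)
     / (1 + norm w) powr (2 * p + (\<Sum>j<n. q j) + (\<Sum>k<m. q' k) + v)"

lemma uhp_weight_homogeneous:
  assumes "Im w > 0"
  shows "uhp_weight n m x x' p q q' v w = (Im w / (1 + norm w)\<^sup>2) powr p *
     ((\<Prod>j<n. (norm (w - of_real (x j)) / (1 + norm w)) powr q j)
      * ((\<Prod>k<m. (norm (w - of_real (x' k)) / (1 + norm w)) powr q' k) * (1 / (1 + norm w)) powr v))"
proof -
  define D where "D = 1 + norm w"
  have D: "D > 0" "D \<noteq> 0" unfolding D_def using norm_ge_zero[of w] by linarith+
  have 1: "(Im w / D\<^sup>2) powr p = Im w powr p / D powr (2 * p)"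
    using assms D by (simp add: powr_divide powr_powr flip: powr_numeral)
  have 2: "(\<Prod>j<n. (norm (w - of_real (x j)) / D) powr q j) = (\<Prod>j<n. norm (w - of_real (x j)) powr q j) / D powr (\<Sum>j<n. q j)"
    for n and x q :: "nat \<Rightarrow> real" using D by (simp add: powr_divide prod_dividef powr_sum)
  have 3: "(1 / D) powr v = 1 / D powr v" using D by (simp add: powr_divide)
  show ?thesis unfolding uhp_weight_def D_def[symmetric] 1 2 3 by (simp add: powr_add)
qed

text \<open>Each factor of one weight is comparable to the matching factor of the other with a
  constant independent of \<open>w\<close>; raising to the absolute values of the exponents covers
  both signs.\<close>

lemma disc_uhp_weight_comparable:
  "\<exists>C>0. \<forall>w. Im w > 0 \<longrightarrow> uhp_weight n m x x' p q q' v w \<le> C * disc_weight n m x x' p q q' v (cayley w)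
     \<and> disc_weight n m x x' p q q' v (cayley w) \<le> C * uhp_weight n m x x' p q q' v w"
proof -
  \<comment> \<open>\<open>norm (of_real t + \<i>)\<close> is the distortion of the Cayley transform
    at the real point \<open>t\<close>; the 4 covers the comparison of
    \<open>norm (w + \<i>)\<close> with \<open>1 + norm w\<close>.\<close>
  define L where "L = (\<lambda>t. 4 + norm (of_real t + \<i>))"
  have L0: "L t > 0" for t unfolding L_def by (auto intro: add_pos_nonneg)
  define C where "C = 16 powr \<bar>p\<bar> * ((\<Prod>j<n. L (x j) powr \<bar>q j\<bar>) * ((\<Prod>k<m. L (x' k) powr \<bar>q' k\<bar>) * 4 powr \<bar>v\<bar>))"
  have "C > 0" unfolding C_def using L0 by (intro mult_pos_pos prod_pos) (auto simp: less_imp_neq[THEN not_sym])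
  moreover have "uhp_weight n m x x' p q q' v w \<le> C * disc_weight n m x x' p q q' v (cayley w)
     \<and> disc_weight n m x x' p q q' v (cayley w) \<le> C * uhp_weight n m x x' p q q' v w" if w: "Im w > 0" for w
  proof -
    let ?z = "cayley w" and ?D = "1 + norm w"
    have wi: "w + \<i> \<noteq> 0" using plus_i_nz[of w] w by simp
    have N: "norm (w + \<i>) \<le> ?D" "?D \<le> 2 * norm (w + \<i>)" "0 < norm (w + \<i>)" "0 < ?D"
      using norm_plus_i_bounds[of w] w wi by (auto intro: add_pos_nonneg)
    have zD: "norm ?z < 1" using cayley_in_ball[OF w] by simp
    have 1: "Im w / ?D\<^sup>2 \<le> 16 * (1 - norm ?z)" "1 - norm ?z \<le> 16 * (Im w / ?D\<^sup>2)" "0 < Im w / ?D\<^sup>2" "0 < 1 - norm ?z"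
    proof -
      have e: "(1 - norm ?z) * (1 + norm ?z) = 4 * Im w / (norm (w + \<i>))\<^sup>2"
        unfolding cayley_one_minus[OF w, symmetric] by (simp add: power2_eq_square algebra_simps)
      have "?D\<^sup>2 \<le> (2 * norm (w + \<i>))\<^sup>2" using N by (intro power_mono) auto
      then have "Im w / (norm (w + \<i>))\<^sup>2 \<le> 4 * (Im w / ?D\<^sup>2)" using w N by (simp add: power_mult_distrib field_simps)
      moreover have "(norm (w + \<i>))\<^sup>2 \<le> ?D\<^sup>2" using N by (intro power_mono) auto
      then have "Im w / ?D\<^sup>2 \<le> Im w / (norm (w + \<i>))\<^sup>2" using w N by (intro divide_left_mono) auto
      moreover have "1 - norm ?z \<le> (1 - norm ?z) * (1 + norm ?z)" using zD mult_left_mono[of 1 "1 + norm ?z" "1 - norm ?z"] by simp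
      moreover have "(1 - norm ?z) * (1 + norm ?z) \<le> (1 - norm ?z) * 2" using zD by (intro mult_left_mono) auto
      moreover show "0 < Im w / ?D\<^sup>2" "0 < 1 - norm ?z" using w N zD by auto
      ultimately show "Im w / ?D\<^sup>2 \<le> 16 * (1 - norm ?z)" "1 - norm ?z \<le> 16 * (Im w / ?D\<^sup>2)" using e by auto
    qed
    have 2: "norm (?z - cayley (of_real t)) \<le> L t * (norm (w - of_real t) / ?D)"
      "norm (w - of_real t) / ?D \<le> L t * norm (?z - cayley (of_real t))"
      "0 < norm (?z - cayley (of_real t))" "0 < norm (w - of_real t) / ?D" for t
    proof -
      define E where "E = norm (of_real t + \<i>)"
      define R where "R = norm (w - of_real t)"
      have E: "1 \<le> E" unfolding E_def using norm_plus_i_bounds(2)[of "of_real t"] abs_Im_le_cmod[of "of_real t + \<i>"] by simp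
      have R: "0 < R" unfolding R_def using w by auto
      have eq: "norm (?z - cayley (of_real t)) = 2 * R / (norm (w + \<i>) * E)"
        using cayley_diff[of w "of_real t"] w unfolding E_def R_def by (simp add: norm_mult norm_divide)
      have "2 * R / (norm (w + \<i>) * E) \<le> 2 * R / (norm (w + \<i>) * 1)"
        using N E R by (intro divide_left_mono mult_left_mono mult_pos_pos) auto
      also have "\<dots> \<le> 4 * (R / ?D)"
      proof -
        have "1 / norm (w + \<i>) \<le> 2 / ?D" using N by (simp add: field_simps)
        then have "2 * R * (1 / norm (w + \<i>)) \<le> 2 * R * (2 / ?D)" using R by (intro mult_left_mono) auto
        then show ?thesis by simp
      qed
      also have "\<dots> \<le> L t * (R / ?D)" unfolding L_def using R N by (intro mult_right_mono) auto
      finally show "norm (?z - cayley (of_real t)) \<le> L t * (norm (w - of_real t) / ?D)" unfolding eq R_def[symmetric] .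
      have "R / ?D \<le> R / norm (w + \<i>)" using N R by (intro divide_left_mono mult_pos_pos) auto
      also have "\<dots> \<le> E * (2 * R / (norm (w + \<i>) * E))" using E N R by (simp add: field_simps)
      also have "\<dots> \<le> L t * (2 * R / (norm (w + \<i>) * E))" unfolding L_def E_def[symmetric] using E R N by (intro mult_right_mono) auto
      finally show "norm (w - of_real t) / ?D \<le> L t * norm (?z - cayley (of_real t))" unfolding eq R_def[symmetric] .
      show "0 < norm (?z - cayley (of_real t))" unfolding eq using R N E by simp
      show "0 < norm (w - of_real t) / ?D" using R N unfolding R_def by simp
    qed
    have 3: "norm (?z - 1) \<le> 4 * (1 / ?D)" "1 / ?D \<le> 4 * norm (?z - 1)" "0 < norm (?z - 1)" "0 < 1 / ?D"
    proof -
      have eq: "norm (?z - 1) = 2 / norm (w + \<i>)" using cayley_minus_one[of w] w by (simp add: norm_divide norm_mult)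
      show "norm (?z - 1) \<le> 4 * (1 / ?D)" "1 / ?D \<le> 4 * norm (?z - 1)" "0 < norm (?z - 1)" "0 < 1 / ?D"
        unfolding eq using N by (auto simp: field_simps)
    qed
    have A: "disc_weight n m x x' p q q' v ?z \<le> (16 powr \<bar>p\<bar> * (Im w / ?D\<^sup>2) powr p)
        * ((\<Prod>j<n. L (x j) powr \<bar>q j\<bar> * (norm (w - of_real (x j)) / ?D) powr q j)
          * ((\<Prod>k<m. L (x' k) powr \<bar>q' k\<bar> * (norm (w - of_real (x' k)) / ?D) powr q' k) * (4 powr \<bar>v\<bar> * (1 / ?D) powr v)))"
      unfolding disc_weight_def using 1 2 3
      by (intro mult_mono prod_mono conjI powr_le_of_comparable mult_nonneg_nonneg prod_nonneg ballI) auto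
    have B: "uhp_weight n m x x' p q q' v w \<le> (16 powr \<bar>p\<bar> * (1 - norm ?z) powr p)
        * ((\<Prod>j<n. L (x j) powr \<bar>q j\<bar> * norm (?z - cayley (of_real (x j))) powr q j)
          * ((\<Prod>k<m. L (x' k) powr \<bar>q' k\<bar> * norm (?z - cayley (of_real (x' k))) powr q' k) * (4 powr \<bar>v\<bar> * norm (?z - 1) powr v)))"
      unfolding uhp_weight_homogeneous[OF w] using 1 2 3
      by (intro mult_mono prod_mono conjI powr_le_of_comparable mult_nonneg_nonneg prod_nonneg ballI) auto
    show ?thesis
    proof
      show "uhp_weight n m x x' p q q' v w \<le> C * disc_weight n m x x' p q q' v ?z"
        using B unfolding disc_weight_def C_def by (simp add: prod.distrib mult_ac)
      show "disc_weight n m x x' p q q' v ?z \<le> C * uhp_weight n m x x' p q q' v w"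
        using A unfolding uhp_weight_homogeneous[OF w] C_def by (simp add: prod.distrib mult_ac)
    qed
  qed
  ultimately show ?thesis by blast
qed

lemma cayley_inv_diff:
  assumes "z \<in> ball 0 1" "z0 \<in> ball 0 1"
  shows "cayley_inv z - cayley_inv z0 = (z - z0) * (2 * \<i> / ((1 - z) * (1 - z0)))"
proof -
  have "1 - z \<noteq> 0" "1 - z0 \<noteq> 0" using assms by auto
  then show ?thesis unfolding cayley_inv_def by (simp add: divide_simps) (simp add: algebra_simps)
qed

lemma uhp_weight_growth:
  "K * (1 + norm w) powr (2 * b) / Im w powr a * (\<Prod>j<n. norm (w - of_real (x j)) powr c j)
      / (\<Prod>k<m. norm (w - of_real (x' k)) powr d k)
    = K * uhp_weight n m x x' (- a) c (\<lambda>k. - d k) (2 * a - 2 * b - (\<Sum>j<n. c j) + (\<Sum>k<m. d k)) w"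
proof -
  have "(\<Prod>k<m. norm (w - of_real (x' k)) powr (- d k)) = inverse (\<Prod>k<m. norm (w - of_real (x' k)) powr d k)"
    unfolding powr_minus using prod_inversef[of "\<lambda>k. norm (w - of_real (x' k)) powr d k"] by (simp add: o_def)
  then show ?thesis unfolding uhp_weight_def by (simp add: sum_negf powr_minus field_simps)
qed

lemma uhp_weight_sum:
  "Im w powr p / (1 + norm w) powr (2 * p + v - (\<Sum>j<n. q j) + (\<Sum>k<m. q' k))
      * (\<Prod>k<m. norm (w - of_real (x' k)) powr q' k) / (\<Prod>j<n. norm (w - of_real (x j)) powr q j)
    = uhp_weight n m x x' p (\<lambda>j. - q j) q' v w"
proof -
  have 1: "(\<Prod>j<n. norm (w - of_real (x j)) powr (- q j)) = inverse (\<Prod>j<n. norm (w - of_real (x j)) powr q j)"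
    unfolding powr_minus using prod_inversef[of "\<lambda>j. norm (w - of_real (x j)) powr q j"] by (simp add: o_def)
  have 2: "2 * p + v - (\<Sum>j<n. q j) + (\<Sum>k<m. q' k) = 2 * p + (\<Sum>j<n. - q j) + (\<Sum>k<m. q' k) + v"
    by (simp add: sum_negf)
  show ?thesis unfolding uhp_weight_def 1 2 by (simp add: divide_inverse)
qed

text \<open>Summability is asserted along with the bound because \<open>infsum\<close> of a
  non-summable family is 0 by convention. The convention \<open>ln 0 = 0\<close> is harmless in the
  growth condition, whose right-hand side is nonnegative.\<close>

theorem theorem4p4:
  fixes n m :: nat and x x' :: "nat \<Rightarrow> real" and c d :: "nat \<Rightarrow> real"
    and a b \<epsilon> :: real
  assumes inj_x: "inj_on x {..<n}" and inj_x': "inj_on x' {..<m}"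
    and disj: "x ` {..<n} \<inter> x' ` {..<m} = {}"
    and a_nn: "a \<ge> 0" and b_nn: "b \<ge> 0"
    and c_nn: "\<And>j. j < n \<Longrightarrow> c j \<ge> 0"
    and d_nn: "\<And>k. k < m \<Longrightarrow> d k \<ge> 0"
    and eps: "\<epsilon> > 0"
  shows "\<exists>C9 > 0. \<forall>(g :: complex \<Rightarrow> complex) (K :: real).
      (K > 0 \<and> g holomorphic_on {w. Im w > 0} \<and> norm (g \<i>) = 1 \<and>
       (\<forall>w. Im w > 0 \<longrightarrow>
          ln (norm (g w)) \<le> K * (1 + norm w) powr (2 * b) / (Im w) powr a
            * (\<Prod>j<n. norm (w - complex_of_real (x j)) powr c j)
            / (\<Prod>k<m. norm (w - complex_of_real (x' k)) powr d k)))
      \<longrightarrow>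
      (let l = 2 * a - 2 * b - (\<Sum>j<n. c j) + (\<Sum>k<m. d k);
           l1 = 2 * (a + 1 + \<epsilon>) + brace l a \<epsilon> - (\<Sum>j<n. min a (c j))
                + (\<Sum>k<m. pos_part (d k - 1 + \<epsilon>));
           F = (\<lambda>\<zeta>. real (nat (zorder g \<zeta>)) *
                 ((Im \<zeta>) powr (a + 1 + \<epsilon>) / (1 + norm \<zeta>) powr l1
                  * (\<Prod>k<m. norm (\<zeta> - complex_of_real (x' k)) powr pos_part (d k - 1 + \<epsilon>))
                  / (\<Prod>j<n. norm (\<zeta> - complex_of_real (x j)) powr min a (c j))))
       in F summable_on zeros_uhp g \<and> infsum F (zeros_uhp g) \<le> C9 * K)"
proof -
  define l where "l = 2 * a - 2 * b - (\<Sum>j<n. c j) + (\<Sum>k<m. d k)"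
  \<comment> \<open>Three kinds of singular points on the circle: the images of the
    \<open>x j\<close> with exponent \<open>c j\<close>, of the \<open>x' k\<close> with exponent
    \<open>- d k\<close>, and the image 1 of infinity with exponent \<open>l\<close>.\<close>
  define I :: "(nat + nat + unit) set" where "I = {..<n} <+> ({..<m} <+> {()})"
  define s where "s = case_sum (\<lambda>j. cayley (of_real (x j))) (case_sum (\<lambda>k. cayley (of_real (x' k))) (\<lambda>u::unit. 1))"
  define \<gamma> where "\<gamma> = case_sum c (case_sum (\<lambda>k. - d k) (\<lambda>u::unit. l))"
  define e where "e = case_sum (\<lambda>j. - min a (c j)) (case_sum (\<lambda>k. pos_part (d k - 1 + \<epsilon>)) (\<lambda>u::unit. brace l a \<epsilon>))"
  interpret D: circle_growth I s \<gamma> a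
  proof
    show "finite I" unfolding I_def by simp
    show "norm (s i) = 1" if "i \<in> I" for i using that unfolding I_def s_def by (auto simp: norm_cayley_real)
  qed (rule a_nn)
  have prodI: "(\<Prod>i\<in>I. h i) = (\<Prod>j<n. h (Inl j)) * ((\<Prod>k<m. h (Inr (Inl k))) * h (Inr (Inr ())))" for h :: "nat + nat + unit \<Rightarrow> real"
    unfolding I_def by (simp add: prod.Plus)
  have growth: "D.growth z = disc_weight n m x x' (- a) c (\<lambda>k. - d k) l z" for z
    unfolding D.growth_def prodI disc_weight_def by (simp add: s_def \<gamma>_def)
  have wt: "(1 - norm z) powr (a + 1 + \<epsilon>) * (\<Prod>i\<in>I. norm (z - s i) powr e i)
      = disc_weight n m x x' (a + 1 + \<epsilon>) (\<lambda>j. - min a (c j)) (\<lambda>k. pos_part (d k - 1 + \<epsilon>)) (brace l a \<epsilon>) z" for z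
    unfolding prodI disc_weight_def s_def e_def by simp
  have cayley_neq: "cayley (of_real u) \<noteq> cayley (of_real v)" if "u \<noteq> v" for u v :: real
    using cayley_diff[of "of_real u" "of_real v"] plus_i_nz[of "of_real u"] plus_i_nz[of "of_real v"] that by auto
  have cayley_neq1: "cayley (of_real u) \<noteq> 1" for u :: real
    using cayley_minus_one[of "of_real u"] plus_i_nz[of "of_real u"] by auto
  have inj: "inj_on s I"
  proof (rule inj_onI)
    fix i j assume ij: "i \<in> I" "j \<in> I" "s i = s j"
    have xx: "x u = x v \<Longrightarrow> u = v" if "u < n" "v < n" for u v using inj_onD[OF inj_x] that by auto
    have xx': "x' u = x' v \<Longrightarrow> u = v" if "u < m" "v < m" for u v using inj_onD[OF inj_x'] that by auto
    have xd: "x u \<noteq> x' v" if "u < n" "v < m" for u v using disj that by blast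
    have eq: "u = v" if "cayley (of_real u) = cayley (of_real v)" for u v :: real using cayley_neq that by blast
    show "i = j"
      using ij unfolding I_def s_def
      by (elim PlusE) (auto dest!: eq dest: xx xx' xd not_sym[OF xd] simp: cayley_neq1 cayley_neq1[symmetric])
  qed
  have c_ge: "- 1 \<le> c j" if "j < n" for j using c_nn[OF that] by linarith
  \<comment> \<open>At the \<open>x j\<close> there is equality; at the \<open>x' k\<close> and at
    infinity the \<open>\<epsilon>\<close> inside the positive part gives the inequality.\<close>
  have e_ge: "D.crit_exp i \<le> e i" if "i \<in> I" for i
    unfolding D.crit_exp_def using that c_nn d_nn a_nn eps
    by (auto simp: I_def \<gamma>_def e_def pos_part_def brace_def neg_part_def intro: c_ge)
  have ne: "I \<noteq> {}" unfolding I_def by simp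
  obtain C0 where C0: "C0 > 0" and disc: "\<And>K f f1 A m'. D.admissible K f f1 A m' \<Longrightarrow>
     (\<Sum>\<zeta>\<in>A. real (m' \<zeta>) * disc_weight n m x x' (a + 1 + \<epsilon>) (\<lambda>j. - min a (c j)) (\<lambda>k. pos_part (d k - 1 + \<epsilon>)) (brace l a \<epsilon>) \<zeta>) \<le> C0 * K"
    using D.zeros_sum_le[of \<epsilon> e, OF ne inj eps] e_ge unfolding wt by blast
  obtain C1 where C1: "C1 > 0" "\<And>w. Im w > 0 \<Longrightarrow> uhp_weight n m x x' (- a) c (\<lambda>k. - d k) l w
      \<le> C1 * disc_weight n m x x' (- a) c (\<lambda>k. - d k) l (cayley w)"
    using disc_uhp_weight_comparable by meson
  define Wd where "Wd = disc_weight n m x x' (a + 1 + \<epsilon>) (\<lambda>j. - min a (c j)) (\<lambda>k. pos_part (d k - 1 + \<epsilon>)) (brace l a \<epsilon>)"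
  define Wu where "Wu = uhp_weight n m x x' (a + 1 + \<epsilon>) (\<lambda>j. - min a (c j)) (\<lambda>k. pos_part (d k - 1 + \<epsilon>)) (brace l a \<epsilon>)"
  obtain C2 where C2: "C2 > 0" "\<And>w. Im w > 0 \<Longrightarrow> Wu w \<le> C2 * Wd (cayley w)"
    unfolding Wu_def Wd_def using disc_uhp_weight_comparable by meson
  define l1 where "l1 = 2 * (a + 1 + \<epsilon>) + brace l a \<epsilon> - (\<Sum>j<n. min a (c j)) + (\<Sum>k<m. pos_part (d k - 1 + \<epsilon>))"
  let ?H = "{w. Im w > 0}"
  have main: "F summable_on zeros_uhp g \<and> infsum F (zeros_uhp g) \<le> C2 * C0 * C1 * K"
    if K: "K > 0" and hol: "g holomorphic_on ?H" and gi: "norm (g \<i>) = 1"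
      and bound: "\<And>w. Im w > 0 \<Longrightarrow> ln (norm (g w)) \<le> K * uhp_weight n m x x' (- a) c (\<lambda>k. - d k) l w"
      and F: "\<And>\<zeta>. \<zeta> \<in> zeros_uhp g \<Longrightarrow> F \<zeta> = real (nat (zorder g \<zeta>)) * Wu \<zeta>" for g K F
  proof -
    \<comment> \<open>A bound uniform over finite sets of zeros yields both summability and the
      estimate of the infinite sum. \<open>C1\<close> transfers the majorant to the disc,
      \<open>C0\<close> is the disc estimate, and \<open>C2\<close> transfers the weight
      back.\<close>
    have fin_sum: "sum F A \<le> C2 * C0 * C1 * K" if A: "finite A" "A \<subseteq> zeros_uhp g" for A
    proof -
      have AH: "Im \<zeta> > 0" "g \<zeta> = 0" if "\<zeta> \<in> A" for \<zeta> using A that unfolding zeros_uhp_def by auto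
      obtain g1 where g1: "g1 holomorphic_on ?H" "\<And>w. Im w > 0 \<Longrightarrow> g w = g1 w * (\<Prod>\<zeta>\<in>A. (w - \<zeta>) ^ nat (zorder g \<zeta>))"
        using factor_zorder[OF hol open_halfspace_Im_gt convex_connected[OF convex_halfspace_Im_gt], of \<i> A] A AH gi by force
      define f where "f = (\<lambda>z. g (cayley_inv z))"
      \<comment> \<open>By \<open>cayley_inv_diff\<close> each factor
        \<open>cayley_inv z - \<zeta>\<close> is \<open>z - cayley \<zeta>\<close> times a zero-free
        function; those functions join the cofactor, so multiplicities are unchanged.\<close>
      define f1 where "f1 = (\<lambda>z. g1 (cayley_inv z) * (\<Prod>\<zeta>\<in>A. (2 * \<i> / ((1 - z) * (1 - cayley \<zeta>))) ^ nat (zorder g \<zeta>)))"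
      define m' where "m' = (\<lambda>z. nat (zorder g (cayley_inv z)))"
      have injA: "inj_on cayley A" by (rule inj_on_inverseI[of _ cayley_inv]) (use AH cayley_inv_cayley in auto)
      have m': "m' (cayley \<zeta>) = nat (zorder g \<zeta>)" if "\<zeta> \<in> A" for \<zeta>
        unfolding m'_def using AH[OF that] cayley_inv_cayley by simp
      have adm: "D.admissible (K * C1) f f1 (cayley ` A) m'"
        unfolding D.admissible_def
      proof (intro conjI ballI)
        show "0 < K * C1" using K C1 by simp
        have nz1: "1 - z \<noteq> 0" if "z \<in> ball 0 1" for z :: complex using that by auto
        have "cayley_inv holomorphic_on ball 0 1"
          unfolding cayley_inv_def using nz1 by (intro holomorphic_intros) auto
        then have "(g1 \<circ> cayley_inv) holomorphic_on ball 0 1"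
          using g1(1) Im_cayley_inv_pos by (intro holomorphic_on_compose_gen[of _ _ g1 ?H]) auto
        then have h1: "(\<lambda>z. g1 (cayley_inv z)) holomorphic_on ball 0 1" by (simp add: o_def)
        have nzA: "1 - cayley \<zeta> \<noteq> 0" if "\<zeta> \<in> A" for \<zeta> using nz1 cayley_in_ball AH[OF that] by blast
        show "f1 holomorphic_on ball 0 1"
          unfolding f1_def by (intro holomorphic_intros h1) (use nz1 nzA in auto)
        show "finite (cayley ` A)" using A by simp
        show "cayley ` A \<subseteq> ball 0 1 - {0}"
        proof -
          have "cayley \<zeta> \<noteq> 0" if "\<zeta> \<in> A" for \<zeta>
          proof
            assume "cayley \<zeta> = 0"
            then have "\<zeta> = \<i>" using cayley_inv_cayley[OF AH(1)[OF that]] by (simp add: cayley_inv_def)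
            then show False using AH(2)[OF that] gi by simp
          qed
          then show ?thesis using cayley_in_ball AH by auto
        qed
        show "norm (f 0) = 1" unfolding f_def cayley_inv_def using gi by simp
        fix z :: complex assume z: "z \<in> ball 0 1"
        have w: "Im (cayley_inv z) > 0" by (rule Im_cayley_inv_pos[OF z])
        have "(\<Prod>\<zeta>\<in>A. (cayley_inv z - \<zeta>) ^ nat (zorder g \<zeta>))
            = (\<Prod>\<zeta>\<in>A. (z - cayley \<zeta>) ^ nat (zorder g \<zeta>) * (2 * \<i> / ((1 - z) * (1 - cayley \<zeta>))) ^ nat (zorder g \<zeta>))"
        proof (rule prod.cong[OF refl])
          fix \<zeta> assume \<zeta>: "\<zeta> \<in> A"
          have "cayley_inv z - \<zeta> = (z - cayley \<zeta>) * (2 * \<i> / ((1 - z) * (1 - cayley \<zeta>)))"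
            using cayley_inv_diff[OF z cayley_in_ball[OF AH(1)[OF \<zeta>]]] cayley_inv_cayley[OF AH(1)[OF \<zeta>]] by simp
          then show "(cayley_inv z - \<zeta>) ^ nat (zorder g \<zeta>)
            = (z - cayley \<zeta>) ^ nat (zorder g \<zeta>) * (2 * \<i> / ((1 - z) * (1 - cayley \<zeta>))) ^ nat (zorder g \<zeta>)"
            by (simp only: power_mult_distrib)
        qed
        moreover have "(\<Prod>\<zeta>\<in>cayley ` A. (z - \<zeta>) ^ m' \<zeta>) = (\<Prod>\<zeta>\<in>A. (z - cayley \<zeta>) ^ nat (zorder g \<zeta>))"
          unfolding prod.reindex[OF injA] o_def using m' by (intro prod.cong) auto
        ultimately show "f z = f1 z * (\<Prod>\<zeta>\<in>cayley ` A. (z - \<zeta>) ^ m' \<zeta>)"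
          unfolding f_def f1_def g1(2)[OF w] by (simp only: prod.distrib mult_ac)
        have "ln (norm (f z)) \<le> K * uhp_weight n m x x' (- a) c (\<lambda>k. - d k) l (cayley_inv z)"
          unfolding f_def by (rule bound[OF w])
        also have "\<dots> \<le> K * (C1 * D.growth z)"
          using C1(2)[OF w] K unfolding growth cayley_cayley_inv[OF z] by (intro mult_left_mono) auto
        finally show "ln (norm (f z)) \<le> K * C1 * D.growth z" by simp
      qed
      have "sum F A \<le> (\<Sum>\<zeta>\<in>A. real (m' (cayley \<zeta>)) * (C2 * Wd (cayley \<zeta>)))"
      proof (rule sum_mono)
        fix \<zeta> assume \<zeta>: "\<zeta> \<in> A"
        then have "F \<zeta> = real (m' (cayley \<zeta>)) * Wu \<zeta>" using F A(2) m' by auto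
        then show "F \<zeta> \<le> real (m' (cayley \<zeta>)) * (C2 * Wd (cayley \<zeta>))"
          using C2(2)[OF AH(1)[OF \<zeta>]] by (simp add: mult_left_mono)
      qed
      also have "\<dots> = C2 * (\<Sum>z\<in>cayley ` A. real (m' z) * Wd z)"
        unfolding sum.reindex[OF injA] sum_distrib_left o_def by (intro sum.cong) auto
      also have "\<dots> \<le> C2 * (C0 * (K * C1))"
        using disc[OF adm] C2(1) unfolding Wd_def by (intro mult_left_mono) auto
      finally show ?thesis by (simp add: mult_ac)
    qed
    have "F summable_on zeros_uhp g"
    proof (rule nonneg_bdd_above_summable_on)
      fix \<zeta> assume "\<zeta> \<in> zeros_uhp g"
      then show "0 \<le> F \<zeta>" using F[of \<zeta>] unfolding Wu_def uhp_weight_def zeros_uhp_def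
        by (auto intro!: mult_nonneg_nonneg divide_nonneg_nonneg prod_nonneg)
    next
      show "bdd_above (sum F ` {A. A \<subseteq> zeros_uhp g \<and> finite A})"
        using fin_sum by (intro bdd_aboveI[of _ "C2 * C0 * C1 * K"]) auto
    qed
    then show ?thesis using infsum_le_finite_sums fin_sum by blast
  qed
  show ?thesis
    unfolding Let_def l_def[symmetric] l1_def[symmetric]
  proof (intro exI[of _ "C2 * C0 * C1"] conjI[of "0 < C2 * C0 * C1"] allI impI)
    show "0 < C2 * C0 * C1" using C0 C1 C2 by simp
    fix g :: "complex \<Rightarrow> complex" and K :: real
    assume *: "K > 0 \<and> g holomorphic_on ?H \<and> norm (g \<i>) = 1 \<and>
       (\<forall>w. Im w > 0 \<longrightarrow>
          ln (norm (g w)) \<le> K * (1 + norm w) powr (2 * b) / (Im w) powr a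
            * (\<Prod>j<n. norm (w - complex_of_real (x j)) powr c j)
            / (\<Prod>k<m. norm (w - complex_of_real (x' k)) powr d k))"
    let ?F = "\<lambda>\<zeta>. real (nat (zorder g \<zeta>)) *
                 ((Im \<zeta>) powr (a + 1 + \<epsilon>) / (1 + norm \<zeta>) powr l1
                  * (\<Prod>k<m. norm (\<zeta> - complex_of_real (x' k)) powr pos_part (d k - 1 + \<epsilon>))
                  / (\<Prod>j<n. norm (\<zeta> - complex_of_real (x j)) powr min a (c j)))"
    show "?F summable_on zeros_uhp g \<and> infsum ?F (zeros_uhp g) \<le> C2 * C0 * C1 * K"
    proof (rule main)
      show "ln (norm (g w)) \<le> K * uhp_weight n m x x' (- a) c (\<lambda>k. - d k) l w" if "Im w > 0" for w
        using * that unfolding l_def uhp_weight_growth[symmetric] by blast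
      show "?F \<zeta> = real (nat (zorder g \<zeta>)) * Wu \<zeta>" if "\<zeta> \<in> zeros_uhp g" for \<zeta>
        using that unfolding l1_def Wu_def zeros_uhp_def by (subst uhp_weight_sum) auto
    qed (use * in auto)
  qed
qed

end
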